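(* Consider the Erdos-Renyi random graph $\mathcal{G}(n,p)$, where the edge probability $p=p(n)$ satisfies $\limsup_{n\to\infty}\frac{\ln n}{np}<1$. Let $S$ be a (nonempty) set of grounded nodes chosen uniformly at random with $|S|=o(\sqrt{np})$. Then the smallest eigenvalue $\lambda$ of the grounded Laplacian $L_g(S)$ of $\mathcal{G}(n,p)$ satisfies $$(1-o(1))\,|S|\,p\;\le\;\lambda\;\le\;(1+o(1))\,|S|\,p$$ asymptotically almost surely.
   Context: $\mathcal{G}(n,p)$ is the random undirected simple graph on $n$ nodes in which each possible edge between two distinct nodes is present independently with probability $p$, where $p$ may be a function of $n$. The size $|S|$ is a function of $n$, and, given this size, $S$ is chosen uniformly among node subsets of that size, independently of the graph; the dependence of $S$ and $\lambda$ on $n$ is suppressed. The Laplacian of a graph is $L=D-A$ (degree matrix minus adjacency matrix); the grounded Laplacian $L_g(S)$ is obtained from $L$ by removing the rows and columns corresponding to the nodes in $S$. A property holds asymptotically almost surely if its probability tends to $1$ as $n\to\infty$. A bound of the form $f\le(1+o(1))g(n)$ holds asymptotically almost surely if there is a (deterministic) function $h(n)\to 0$ such that $f\le(1+h(n))g(n)$ with probability tending to $1$ as $n\to\infty$; similarly for lower bounds of the form $(1-o(1))g(n)\le f$. *)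

theory Defs
  imports
    "HOL-Probability.Product_PMF"
    "HOL-Library.Landau_Symbols"
    "Jordan_Normal_Form.DL_Submatrix"
    "Jordan_Normal_Form.Spectral_Radius"
begin

text \<open>A simple undirected graph on the nodes \<open>{..<n}\<close> is given by its set of edges, which are
  two-element subsets of \<open>{..<n}\<close>.\<close>

definition possible_edges :: "nat \<Rightarrow> nat set set" where
  "possible_edges n = {e. e \<subseteq> {..<n} \<and> card e = 2}"

definition erdos_renyi :: "nat \<Rightarrow> real \<Rightarrow> nat set set pmf" where
  "erdos_renyi n p =
     map_pmf (\<lambda>X. {e \<in> possible_edges n. X e})
       (Pi_pmf (possible_edges n) False (\<lambda>_. bernoulli_pmf p))"

definition adjacency_matrix :: "nat \<Rightarrow> nat set set \<Rightarrow> real mat" where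
  "adjacency_matrix n E = Matrix.mat n n (\<lambda>(i, j). if {i, j} \<in> E then 1 else 0)"

definition degree_matrix :: "nat \<Rightarrow> nat set set \<Rightarrow> real mat" where
  "degree_matrix n E =
     Matrix.mat n n (\<lambda>(i, j). if i = j then real (card {e \<in> E. i \<in> e}) else 0)"

definition laplacian :: "nat \<Rightarrow> nat set set \<Rightarrow> real mat" where
  "laplacian n E = degree_matrix n E - adjacency_matrix n E"

definition grounded_laplacian :: "nat \<Rightarrow> nat set set \<Rightarrow> nat set \<Rightarrow> real mat" where
  "grounded_laplacian n E S = submatrix (laplacian n E) ({..<n} - S) ({..<n} - S)"

text \<open>Only applied to real symmetric matrices, for which the real spectrum contains all
  eigenvalues; it is unspecified for the empty matrix.\<close>

definition smallest_eigenvalue :: "real mat \<Rightarrow> real" where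
  "smallest_eigenvalue M = Min (spectrum M)"

text \<open>The graph and the set of \<open>s\<close> grounded nodes are drawn independently.\<close>

definition grounded_erdos_renyi :: "nat \<Rightarrow> real \<Rightarrow> nat \<Rightarrow> (nat set set \<times> nat set) pmf" where
  "grounded_erdos_renyi n p s =
     pair_pmf (erdos_renyi n p) (pmf_of_set {S. S \<subseteq> {..<n} \<and> card S = s})"

definition asymptotically_almost_surely ::
  "(nat \<Rightarrow> 'a pmf) \<Rightarrow> (nat \<Rightarrow> 'a \<Rightarrow> bool) \<Rightarrow> bool" where
  "asymptotically_almost_surely M P \<longleftrightarrow>
     (\<lambda>n. measure_pmf.prob (M n) {x. P n x}) \<longlonglongrightarrow> 1"

text \<open>In the extended reals the ratio \<open>ln n / (n p)\<close> is infinite where \<open>p\<close> vanishes (real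
  division would give \<open>0\<close>), so bounding its limes superior excludes \<open>p n = 0\<close> for large \<open>n\<close>.\<close>

lemma ln_div_zero_ereal: "n \<ge> 2 \<Longrightarrow> ereal (ln (real n)) / ereal (real n * 0) = \<infinity>"
  by (simp add: divide_ereal_def)

end

theory Submission
  imports Defs "HOL-Real_Asymp.Real_Asymp"
begin

text \<open>Let \<open>W\<close> be the set of nodes outside \<open>S\<close>, let \<open>m = |W|\<close> and \<open>\<mu> = n p\<close>, and let
  \<open>d a\<close> be the number of neighbours that \<open>a \<in> W\<close> has in \<open>S\<close>. The quadratic form of the grounded
  Laplacian at a function \<open>f\<close> on \<open>W\<close> is the energy of \<open>f\<close> (the sum of \<open>(f a - f b)\<^sup>2\<close> over the
  edges inside \<open>W\<close>) plus the sum of \<open>d a * (f a)\<^sup>2\<close> (\<open>grounded_quadratic_form\<close>), and the smallest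
  eigenvalue is the best constant in front of the squared norm of \<open>f\<close> (\<open>rayleigh_minimum_attained\<close>).

  Upper bound: the constant function has no energy, so \<open>\<lambda>\<close> is at most the number of edges between
  \<open>W\<close> and \<open>S\<close> divided by \<open>m\<close>. This number is binomial with mean \<open>|S| m p\<close>, which tends to infinity,
  so Chebyshev's inequality applies.

  Lower bound: write \<open>f\<close> as its mean plus a function \<open>g\<close> of mean zero, and let \<open>\<Lambda>\<close> be the spectral
  gap of the graph induced on \<open>W\<close>. The mean contributes about \<open>|S| p\<close>, the energy is at least
  \<open>\<Lambda>\<close> times the squared norm of \<open>g\<close>, and the mixed term is controlled by the second moment of
  \<open>d\<close>, which is about \<open>|S| p + (|S| p)\<^sup>2\<close> per node. Minimising over the size of \<open>g\<close> loses at most about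
  \<open>(|S| p + (|S| p)\<^sup>2) / (\<Lambda> - |S| p)\<close> (\<open>grounded_form_lower_bound\<close>). As \<open>|S| p \<le> |S| \<le> sqrt \<mu>\<close>,
  this is of smaller order than \<open>|S| p\<close> once \<open>\<Lambda>\<close> is of order \<open>\<mu>\<close>.

  The spectral gap comes from Cheeger's inequality (\<open>cheeger_inequality\<close>): degrees are at most
  \<open>4 \<mu>\<close>, and every \<open>T\<close> with at most half of the nodes of \<open>W\<close> has at least \<open>\<gamma> \<mu> |T|\<close> edges leaving it,
  for a small constant \<open>\<gamma>\<close>. The latter is a union bound over Chernoff estimates
  (\<open>prob_expansion_fails\<close>). A single node has degree below \<open>\<gamma> \<mu>\<close> with probability about
  \<open>exp (-\<mu>)\<close>, up to a factor close to 1 in the exponent, and there are \<open>n\<close> nodes, so \<open>ln n \<le> c \<mu>\<close>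
  with \<open>c < 1\<close> is what makes all degrees large. The estimate for a small set of size \<open>k\<close> is roughly the
  \<open>k\<close>-th power of the one for a node, and for sets with a positive fraction of the nodes the
  probability \<open>exp (-const m \<mu>)\<close> beats their number, at most \<open>2 ^ m\<close>.

  All estimates hold for each fixed \<open>S\<close>, with a bound on the failure probability that is the same for
  all \<open>S\<close> of the given size, so they survive averaging over \<open>S\<close>.\<close>

(* In the matrix part the dot product and the indexing of vectors are those for vectors of
   variable dimension. *)
unbundle no inner_syntax and no vec_syntax

section \<open>The smallest eigenvalue as a Rayleigh quotient\<close>

definition quadratic_form :: "real mat \<Rightarrow> real vec \<Rightarrow> real" where
  "quadratic_form A v = v \<bullet> (A *\<^sub>v v)"

text \<open>Crude, but it serves twice: it shows that the set of lower bounds of the Rayleigh quotient is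
  nonempty, and it bounds the form of an inverse matrix.\<close>

lemma quadratic_form_bound:
  assumes A: "A \<in> carrier_mat n n"
  shows "\<exists>C>0. \<forall>v\<in>carrier_vec n. \<bar>quadratic_form A v\<bar> \<le> C * (v \<bullet> v)"
proof -
  define C where "C = 1 + (\<Sum>i<n. \<Sum>j<n. \<bar>A $$ (i, j)\<bar>)"
  have "\<bar>quadratic_form A v\<bar> \<le> C * (v \<bullet> v)" if v: "v \<in> carrier_vec n" for v
  proof -
    have vv: "v \<bullet> v = (\<Sum>i<n. (v $ i)\<^sup>2)"
      using v by (simp add: scalar_prod_def power2_eq_square atLeast0LessThan)
    have sq: "\<bar>v $ i * v $ j\<bar> \<le> v \<bullet> v" if "i < n" "j < n" for i j
    proof -
      have *: "(v $ k)\<^sup>2 \<le> v \<bullet> v" if "k < n" for k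
        unfolding vv using that by (intro member_le_sum) auto
      have "2 * \<bar>v $ i * v $ j\<bar> \<le> (v $ i)\<^sup>2 + (v $ j)\<^sup>2"
        using sum_squares_bound[of "\<bar>v $ i\<bar>" "\<bar>v $ j\<bar>"] by (simp add: abs_mult)
      with *[OF that(1)] *[OF that(2)] show ?thesis by linarith
    qed
    have "quadratic_form A v = (\<Sum>i<n. \<Sum>j<n. A $$ (i, j) * (v $ i * v $ j))"
      using A v by (simp add: quadratic_form_def scalar_prod_def row_def sum_distrib_left
          atLeast0LessThan mult_ac)
    also have "\<bar>\<dots>\<bar> \<le> (\<Sum>i<n. \<Sum>j<n. \<bar>A $$ (i, j)\<bar> * \<bar>v $ i * v $ j\<bar>)"
      by (rule order.trans[OF sum_abs] sum_mono)+ (auto simp: abs_mult)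
    also have "\<dots> \<le> (\<Sum>i<n. \<Sum>j<n. \<bar>A $$ (i, j)\<bar> * (v \<bullet> v))"
      by (intro sum_mono mult_left_mono sq) auto
    also have "\<dots> = (\<Sum>i<n. \<Sum>j<n. \<bar>A $$ (i, j)\<bar>) * (v \<bullet> v)"
      by (simp add: sum_distrib_right)
    also have "\<dots> \<le> C * (v \<bullet> v)"
      unfolding C_def vv by (simp add: algebra_simps sum_nonneg)
    finally show ?thesis .
  qed
  moreover have "C > 0"
    unfolding C_def by (intro add_pos_nonneg sum_nonneg) auto
  ultimately show ?thesis by blast
qed

lemma quadratic_form_char_matrix:
  assumes "A \<in> carrier_mat n n" "v \<in> carrier_vec n"
  shows "quadratic_form (char_matrix A t) v = quadratic_form A v - t * (v \<bullet> v)"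
proof -
  have "char_matrix A t *\<^sub>v v = A *\<^sub>v v - t \<cdot>\<^sub>v v"
    using assms unfolding char_matrix_def
    by (auto simp: scalar_prod_def sum.distrib sum_distrib_left algebra_simps
         if_distrib[of "\<lambda>x. x * _"] if_distrib[of "\<lambda>x. _ * x"] cong: if_cong intro!: eq_vecI)
  then show ?thesis
    using assms by (simp add: quadratic_form_def scalar_prod_minus_distrib)
qed

lemma transpose_scalar_prod:
  fixes A :: "real mat"
  assumes "A \<in> carrier_mat n n" "u \<in> carrier_vec n" "v \<in> carrier_vec n"
  shows "u \<bullet> (A *\<^sub>v v) = v \<bullet> (transpose_mat A *\<^sub>v u)"
  using transpose_vec_mult_scalar[OF assms(1,3,2)] assms
  by (metis comm_scalar_prod mult_mat_vec_carrier transpose_carrier_mat)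

text \<open>The spectral theorem is bypassed by a perturbation argument. Let \<open>\<theta>\<close> be the supremum of all lower
  bounds of the Rayleigh quotient, so that \<open>M = A - \<theta>\<close> is positive semidefinite. If \<open>M\<close> had an
  inverse \<open>N\<close>, evaluating the form of \<open>M\<close> at \<open>x - \<tau> N x\<close> would give
  \<open>0 \<le> x M x - 2 \<tau> x x + \<tau>\<^sup>2 x N x\<close>; with \<open>\<tau> = 1 / D\<close>, where \<open>D\<close> bounds the form of \<open>N\<close>, this says
  \<open>x M x \<ge> x x / D\<close>, and \<open>\<theta> + 1 / D\<close> would be a larger lower bound. So \<open>\<theta>\<close> is an eigenvalue.\<close>

lemma rayleigh_minimum_attained:
  assumes A: "A \<in> carrier_mat n n" and sym: "transpose_mat A = A" and n: "n > 0"
  shows "smallest_eigenvalue A \<in> spectrum A" 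
    and "v \<in> carrier_vec n \<Longrightarrow> smallest_eigenvalue A * (v \<bullet> v) \<le> quadratic_form A v"
proof -
  define T where "T = {t. \<forall>v\<in>carrier_vec n. t * (v \<bullet> v) \<le> quadratic_form A v}"
  define \<theta> where "\<theta> = Sup T"
  obtain C where C: "C > 0" "\<And>v. v \<in> carrier_vec n \<Longrightarrow> \<bar>quadratic_form A v\<bar> \<le> C * (v \<bullet> v)"
    using quadratic_form_bound[OF A] by blast
  have "-C \<in> T" unfolding T_def using C(2) by (force simp: abs_le_iff)
  have uu: "unit_vec n 0 \<bullet> unit_vec n 0 = (1::real)" using n by simp
  have bdd: "bdd_above T"
    unfolding T_def by (rule bdd_aboveI[of _ "quadratic_form A (unit_vec n 0)"])
      (use uu in \<open>auto dest!: bspec[where x = "unit_vec n 0"]\<close>)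
  have nonneg: "v \<bullet> v \<ge> (0::real)" for v :: "real vec"
    by (simp add: scalar_prod_def sum_nonneg)
  have \<theta>: "\<theta> * (v \<bullet> v) \<le> quadratic_form A v" if v: "v \<in> carrier_vec n" for v
  proof (cases "v \<bullet> v = 0")
    case True
    with C(2)[OF v] show ?thesis by simp
  next
    case False
    with nonneg[of v] have pos: "v \<bullet> v > 0" by linarith
    have "\<theta> \<le> quadratic_form A v / (v \<bullet> v)"
      unfolding \<theta>_def
    proof (rule cSup_least)
      show "T \<noteq> {}" using \<open>-C \<in> T\<close> by blast
    qed (use v pos in \<open>auto simp: T_def field_simps\<close>)
    with pos show ?thesis by (simp add: field_simps)
  qed
  define M where "M = char_matrix A \<theta>"
  have M: "M \<in> carrier_mat n n" unfolding M_def using A by simp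
  have "A $$ (i, j) = A $$ (j, i)" if "i < n" "j < n" for i j
    using A sym that by (metis carrier_matD index_transpose_mat(1))
  then have Msym: "transpose_mat M = M"
    unfolding M_def char_matrix_def using A by (intro eq_matI) auto
  have psd: "quadratic_form M v \<ge> 0" if "v \<in> carrier_vec n" for v
    using \<theta>[OF that] quadratic_form_char_matrix[OF A that] unfolding M_def by simp
  have "eigenvalue A \<theta>"
  proof (rule ccontr)
    assume "\<not> eigenvalue A \<theta>"
    then have "det M \<noteq> 0" using eigenvalue_det[OF A] unfolding M_def by simp
    then obtain N where N: "N \<in> carrier_mat n n" "M * N = 1\<^sub>m n"
      using det_non_zero_imp_unit[OF M] unfolding Units_def ring_mat_def by auto
    obtain D where D: "D > 0" "\<And>v. v \<in> carrier_vec n \<Longrightarrow> \<bar>quadratic_form N v\<bar> \<le> D * (v \<bullet> v)"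
      using quadratic_form_bound[OF N(1)] by blast
    have gap: "quadratic_form M x \<ge> (x \<bullet> x) / D" if x: "x \<in> carrier_vec n" for x
    proof -
      define y where "y = N *\<^sub>v x"
      have y: "y \<in> carrier_vec n" unfolding y_def using N x by simp
      have My: "M *\<^sub>v y = x"
        unfolding y_def using assoc_mult_mat_vec[OF M N(1) x] N(2) x by simp
      have Mx: "M *\<^sub>v x \<in> carrier_vec n" using M x by simp
      have yMx: "y \<bullet> (M *\<^sub>v x) = x \<bullet> x"
        using transpose_scalar_prod[OF M y x] unfolding Msym My .
      have "0 \<le> quadratic_form M (x - (1 / D) \<cdot>\<^sub>v y)"
        using x y by (intro psd) simp
      also have "M *\<^sub>v (x - (1 / D) \<cdot>\<^sub>v y) = M *\<^sub>v x - (1 / D) \<cdot>\<^sub>v x"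
        using M x y My by (simp add: mult_minus_distrib_mat_vec mult_mat_vec)
      then have "quadratic_form M (x - (1 / D) \<cdot>\<^sub>v y) =
          quadratic_form M x - (1 / D) * (x \<bullet> x) - (1 / D) * (x \<bullet> x) + (1 / D)\<^sup>2 * (y \<bullet> x)"
        using x y Mx yMx unfolding quadratic_form_def
        by (simp add: minus_scalar_prod_distrib[of _ n] scalar_prod_minus_distrib[of _ n]
             power2_eq_square algebra_simps)
      also have "y \<bullet> x = quadratic_form N x"
        unfolding quadratic_form_def y_def using x N by (intro comm_scalar_prod[of _ n]) auto
      finally have "2 * (x \<bullet> x) / D \<le> quadratic_form M x + (1 / D)\<^sup>2 * quadratic_form N x"
        by simp
      also have "(1 / D)\<^sup>2 * quadratic_form N x \<le> (1 / D)\<^sup>2 * (D * (x \<bullet> x))"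
        using D(2)[OF x] by (intro mult_left_mono) auto
      also have "\<dots> = (x \<bullet> x) / D" using D(1) by (simp add: field_simps power2_eq_square)
      finally show ?thesis by simp
    qed
    have "\<theta> + 1 / D \<in> T"
      unfolding T_def using gap quadratic_form_char_matrix[OF A, of _ \<theta>]
      by (auto simp: M_def algebra_simps)
    then have "\<theta> + 1 / D \<le> \<theta>" unfolding \<theta>_def using bdd by (rule cSup_upper)
    with D(1) show False by simp
  qed
  then have in_spec: "\<theta> \<in> spectrum A" by (simp add: spectrum_def)
  have least: "\<theta> \<le> k" if k: "k \<in> spectrum A" for k
  proof -
    obtain v where v: "v \<in> carrier_vec n" "v \<noteq> 0\<^sub>v n" "A *\<^sub>v v = k \<cdot>\<^sub>v v"
      using k A unfolding spectrum_def eigenvalue_def eigenvector_def by auto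
    have "v \<bullet> v \<noteq> 0"
      using v(1,2) conjugate_square_eq_0_vec[of v n] by simp
    with nonneg[of v] have "v \<bullet> v > 0" by linarith
    moreover have "quadratic_form A v = k * (v \<bullet> v)"
      using v unfolding quadratic_form_def by simp
    ultimately show ?thesis using \<theta>[OF v(1)] by simp
  qed
  have "smallest_eigenvalue A = \<theta>"
    unfolding smallest_eigenvalue_def
    using card_finite_spectrum(1)[OF A] in_spec least by (intro Min_eqI) auto
  with in_spec \<theta> show "smallest_eigenvalue A \<in> spectrum A"
    "v \<in> carrier_vec n \<Longrightarrow> smallest_eigenvalue A * (v \<bullet> v) \<le> quadratic_form A v" by auto
qed

lemma smallest_eigenvalue_ge:
  assumes A: "A \<in> carrier_mat n n" and sym: "transpose_mat A = A" and n: "n > 0"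
    and bound: "\<And>v. v \<in> carrier_vec n \<Longrightarrow> b * (v \<bullet> v) \<le> quadratic_form A v"
  shows "b \<le> smallest_eigenvalue A"
proof -
  obtain v where v: "v \<in> carrier_vec n" "v \<noteq> 0\<^sub>v n" "A *\<^sub>v v = smallest_eigenvalue A \<cdot>\<^sub>v v"
    using rayleigh_minimum_attained(1)[OF A sym n] A
    unfolding spectrum_def eigenvalue_def eigenvector_def by auto
  have "v \<bullet> v \<ge> 0" by (simp add: scalar_prod_def sum_nonneg)
  moreover have "v \<bullet> v \<noteq> 0"
    using v(1,2) conjugate_square_eq_0_vec[of v n] by simp
  ultimately have "v \<bullet> v > 0" by linarith
  moreover have "quadratic_form A v = smallest_eigenvalue A * (v \<bullet> v)"
    using v unfolding quadratic_form_def by simp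
  ultimately show ?thesis using bound[OF v(1)] by simp
qed

section \<open>Cheeger's inequality for weighted graphs\<close>

locale weighted_graph =
  fixes W :: "'a set" and c :: "'a \<Rightarrow> 'a \<Rightarrow> real"
  assumes finite_nodes: "finite W"
    and weight_sym: "c a b = c b a"
    and weight_nonneg: "0 \<le> c a b"
begin

definition cut :: "'a set \<Rightarrow> real" where
  "cut T = (\<Sum>a\<in>T. \<Sum>b\<in>W - T. c a b)"

text \<open>The double sum meets every edge in both directions.\<close>

definition energy :: "('a \<Rightarrow> real) \<Rightarrow> real" where
  "energy f = (\<Sum>a\<in>W. \<Sum>b\<in>W. c a b * (f a - f b)\<^sup>2) / 2"

lemma energy_shift: "energy (\<lambda>a. f a - r) = energy f"
  by (simp add: energy_def)

lemma cut_eq_symmetric_difference: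
  assumes "T \<subseteq> W"
  shows "(\<Sum>a\<in>W. \<Sum>b\<in>W. c a b * of_bool ((a \<in> T) \<noteq> (b \<in> T))) = 2 * cut T"
proof -
  have split: "sum g W = sum g T + sum g (W - T)" for g :: "'a \<Rightarrow> real"
    using assms finite_nodes by (simp add: sum.subset_diff add.commute)
  have "(\<Sum>a\<in>W. \<Sum>b\<in>W. c a b * of_bool ((a \<in> T) \<noteq> (b \<in> T)))
      = (\<Sum>a\<in>T. \<Sum>b\<in>W - T. c a b) + (\<Sum>a\<in>W - T. \<Sum>b\<in>T. c a b)"
    by (simp add: split)
  also have "(\<Sum>a\<in>W - T. \<Sum>b\<in>T. c a b) = cut T"
    unfolding cut_def by (subst sum.swap) (simp add: weight_sym)
  finally show ?thesis by (simp add: cut_def)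
qed

text \<open>Discrete co-area formula by peeling: subtracting the least positive value \<open>\<delta>\<close> of \<open>w\<close> on its
  support \<open>T\<close> lowers the sum of \<open>w\<close> by \<open>\<delta> |T|\<close> and the total variation by \<open>\<delta>\<close> times the cut of \<open>T\<close>,
  counted in both directions, and it makes the support smaller.\<close>

lemma coarea_inequality:
  fixes h :: real
  assumes expand: "\<And>T. T \<subseteq> W \<Longrightarrow> 2 * card T \<le> card W \<Longrightarrow> h * card T \<le> cut T"
    and nonneg: "\<And>a. a \<in> W \<Longrightarrow> 0 \<le> w a"
    and support: "2 * card {a \<in> W. 0 < w a} \<le> card W"
  shows "2 * h * (\<Sum>a\<in>W. w a) \<le> (\<Sum>a\<in>W. \<Sum>b\<in>W. c a b * \<bar>w a - w b\<bar>)"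
  using nonneg support
proof (induction "card {a \<in> W. 0 < w a}" arbitrary: w rule: less_induct)
  case less
  define T where "T = {a \<in> W. 0 < w a}"
  have T: "T \<subseteq> W" "finite T" unfolding T_def using finite_nodes by auto
  show ?case
  proof (cases "T = {}")
    case True
    then have "w a = 0" if "a \<in> W" for a
      using less.prems(1)[OF that] that unfolding T_def by force
    then show ?thesis by simp
  next
    case False
    define \<delta> where "\<delta> = Min (w ` T)"
    have \<delta>_le: "\<delta> \<le> w a" if "a \<in> T" for a
      unfolding \<delta>_def using that T by simp
    have "\<delta> \<in> w ` T" unfolding \<delta>_def using T False by (intro Min_in) auto
    then obtain a0 where a0: "a0 \<in> T" "w a0 = \<delta>" by auto
    then have \<delta>_pos: "\<delta> > 0" unfolding T_def by auto
    define w' where "w' a = max (w a - \<delta>) 0" for a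
    have w: "w a = w' a + \<delta> * of_bool (a \<in> T)" if "a \<in> W" for a
      using less.prems(1)[OF that] \<delta>_le[of a] \<delta>_pos that
      unfolding w'_def T_def by (cases "0 < w a") auto
    have "a0 \<notin> {a \<in> W. 0 < w' a}" using a0 unfolding w'_def by simp
    moreover have "{a \<in> W. 0 < w' a} \<subseteq> T" using \<delta>_pos unfolding w'_def T_def by auto
    ultimately have "{a \<in> W. 0 < w' a} \<subset> T" using a0(1) by blast
    then have smaller: "card {a \<in> W. 0 < w' a} < card T"
      using T by (intro psubset_card_mono)
    have IH: "2 * h * (\<Sum>a\<in>W. w' a) \<le> (\<Sum>a\<in>W. \<Sum>b\<in>W. c a b * \<bar>w' a - w' b\<bar>)"
      using smaller less.prems(2) unfolding T_def
      by (intro less.hyps) (auto simp: w'_def)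
    have diff: "\<bar>w a - w b\<bar> = \<bar>w' a - w' b\<bar> + \<delta> * of_bool ((a \<in> T) \<noteq> (b \<in> T))"
      if "a \<in> W" "b \<in> W" for a b
    proof -
      have "w' x = 0" if "x \<in> W" "x \<notin> T" for x
        using w[OF that(1)] that less.prems(1)[OF that(1)] unfolding T_def by auto
      moreover have "w' a \<ge> 0" "w' b \<ge> 0" unfolding w'_def by simp_all
      ultimately show ?thesis using w[OF that(1)] w[OF that(2)] \<delta>_pos that
        by (cases "a \<in> T"; cases "b \<in> T") auto
    qed
    have "2 * h * (\<Sum>a\<in>W. w a) = 2 * h * (\<Sum>a\<in>W. w' a) + \<delta> * (2 * (h * card T))"
    proof -
      have "(\<Sum>a\<in>W. w a) = (\<Sum>a\<in>W. w' a) + \<delta> * (\<Sum>a\<in>W. of_bool (a \<in> T))"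
        using w by (simp add: sum.distrib sum_distrib_left)
      also have "(\<Sum>a\<in>W. of_bool (a \<in> T)) = real (card T)"
        using T finite_nodes by (simp add: of_bool_def sum.If_cases Int_absorb1)
      finally show ?thesis by (simp add: algebra_simps)
    qed
    also have "\<dots> \<le> (\<Sum>a\<in>W. \<Sum>b\<in>W. c a b * \<bar>w' a - w' b\<bar>) + \<delta> * (2 * cut T)"
      using IH expand[OF T(1)] less.prems(2) \<delta>_pos unfolding T_def
      by (intro add_mono mult_left_mono) auto
    also have "\<dots> = (\<Sum>a\<in>W. \<Sum>b\<in>W. c a b * \<bar>w' a - w' b\<bar>
        + \<delta> * (c a b * of_bool ((a \<in> T) \<noteq> (b \<in> T))))"
      unfolding cut_eq_symmetric_difference[OF T(1), symmetric]
      by (simp only: sum.distrib sum_distrib_left)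
    also have "\<dots> = (\<Sum>a\<in>W. \<Sum>b\<in>W. c a b * \<bar>w a - w b\<bar>)"
      by (intro sum.cong refl) (simp add: diff algebra_simps)
    finally show ?thesis .
  qed
qed

text \<open>The co-area inequality is applied to \<open>w\<^sup>2\<close>. As \<open>|x\<^sup>2 - y\<^sup>2| = |x - y| |x + y|\<close>, Cauchy-Schwarz
  splits the total variation of \<open>w\<^sup>2\<close> into the energy of \<open>w\<close> and a sum over \<open>(w a + w b)\<^sup>2\<close>, and the
  latter is at most \<open>4 \<Delta>\<close> times the squared norm of \<open>w\<close>.\<close>

lemma cheeger_small_support:
  fixes h :: real
  assumes h: "0 \<le> h"
    and expand: "\<And>T. T \<subseteq> W \<Longrightarrow> 2 * card T \<le> card W \<Longrightarrow> h * card T \<le> cut T"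
    and degree: "\<And>a. a \<in> W \<Longrightarrow> (\<Sum>b\<in>W. c a b) \<le> \<Delta>"
    and nonneg: "\<And>a. a \<in> W \<Longrightarrow> 0 \<le> w a"
    and support: "2 * card {a \<in> W. 0 < w a} \<le> card W"
  shows "h\<^sup>2 * (\<Sum>a\<in>W. (w a)\<^sup>2) \<le> 2 * \<Delta> * energy w"
proof -
  define X where "X = (\<Sum>a\<in>W. (w a)\<^sup>2)"
  have X: "X \<ge> 0" unfolding X_def by (simp add: sum_nonneg)
  have energy: "energy w \<ge> 0"
    unfolding energy_def by (simp add: sum_nonneg weight_nonneg)
  have plus: "(\<Sum>a\<in>W. \<Sum>b\<in>W. c a b * (w a + w b)\<^sup>2) \<le> 4 * \<Delta> * X"
  proof -
    have "(x + y)\<^sup>2 \<le> 2 * x\<^sup>2 + 2 * y\<^sup>2" for x y :: real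
      using sum_squares_bound[of x y] by (simp add: power2_sum)
    then have "(\<Sum>a\<in>W. \<Sum>b\<in>W. c a b * (w a + w b)\<^sup>2)
        \<le> (\<Sum>a\<in>W. \<Sum>b\<in>W. c a b * (2 * (w a)\<^sup>2 + 2 * (w b)\<^sup>2))"
      by (intro sum_mono mult_left_mono weight_nonneg)
    also have "\<dots> = (\<Sum>a\<in>W. \<Sum>b\<in>W. c a b * (2 * (w a)\<^sup>2))
        + (\<Sum>a\<in>W. \<Sum>b\<in>W. c a b * (2 * (w b)\<^sup>2))"
      by (simp add: distrib_left sum.distrib)
    also have "(\<Sum>a\<in>W. \<Sum>b\<in>W. c a b * (2 * (w b)\<^sup>2)) = (\<Sum>a\<in>W. \<Sum>b\<in>W. c a b * (2 * (w a)\<^sup>2))"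
      by (subst sum.swap) (simp add: weight_sym)
    also have "(\<Sum>a\<in>W. \<Sum>b\<in>W. c a b * (2 * (w a)\<^sup>2)) = (\<Sum>a\<in>W. (\<Sum>b\<in>W. c a b) * (2 * (w a)\<^sup>2))"
      by (simp add: sum_distrib_right)
    also have "\<dots> \<le> (\<Sum>a\<in>W. \<Delta> * (2 * (w a)\<^sup>2))"
      by (intro sum_mono mult_right_mono degree) auto
    also have "\<dots> = 2 * \<Delta> * X"
      by (simp add: X_def sum_distrib_left mult_ac)
    finally show ?thesis by (simp add: mult_ac)
  qed
  have "2 * h * X \<le> (\<Sum>a\<in>W. \<Sum>b\<in>W. c a b * \<bar>(w a)\<^sup>2 - (w b)\<^sup>2\<bar>)"
    unfolding X_def
  proof (rule coarea_inequality[OF expand])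
    have "{a \<in> W. 0 < (w a)\<^sup>2} = {a \<in> W. 0 < w a}" using nonneg by force
    then show "2 * card {a \<in> W. 0 < (w a)\<^sup>2} \<le> card W" using support by simp
  qed auto
  also have "\<dots> = (\<Sum>(a, b)\<in>W \<times> W. (sqrt (c a b) * \<bar>w a - w b\<bar>) * (sqrt (c a b) * \<bar>w a + w b\<bar>))"
    unfolding sum.cartesian_product[symmetric]
  proof (intro sum.cong refl)
    fix a b
    have "\<bar>(w a)\<^sup>2 - (w b)\<^sup>2\<bar> = \<bar>w a - w b\<bar> * \<bar>w a + w b\<bar>"
      by (simp add: abs_mult[symmetric] power2_eq_square algebra_simps)
    moreover have "c a b = sqrt (c a b) * sqrt (c a b)" using weight_nonneg by simp
    ultimately show "c a b * \<bar>(w a)\<^sup>2 - (w b)\<^sup>2\<bar>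
        = (sqrt (c a b) * \<bar>w a - w b\<bar>) * (sqrt (c a b) * \<bar>w a + w b\<bar>)"
      by (metis mult.assoc mult.left_commute)
  qed
  finally have "(2 * h * X)\<^sup>2 \<le>
      (\<Sum>(a, b)\<in>W \<times> W. (sqrt (c a b) * \<bar>w a - w b\<bar>) * (sqrt (c a b) * \<bar>w a + w b\<bar>))\<^sup>2"
    using h X by (intro power_mono) auto
  also have "\<dots> \<le> (\<Sum>(a, b)\<in>W \<times> W. (sqrt (c a b) * \<bar>w a - w b\<bar>)\<^sup>2)
      * (\<Sum>(a, b)\<in>W \<times> W. (sqrt (c a b) * \<bar>w a + w b\<bar>)\<^sup>2)"
    using Cauchy_Schwarz_ineq_sum[of "\<lambda>(a, b). sqrt (c a b) * \<bar>w a - w b\<bar>"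
        "\<lambda>(a, b). sqrt (c a b) * \<bar>w a + w b\<bar>" "W \<times> W"]
    by (simp add: case_prod_unfold)
  also have "\<dots> = (2 * energy w) * (\<Sum>a\<in>W. \<Sum>b\<in>W. c a b * (w a + w b)\<^sup>2)"
    unfolding sum.cartesian_product[symmetric] energy_def
    by (simp add: power_mult_distrib weight_nonneg)
  also have "\<dots> \<le> (2 * energy w) * (4 * \<Delta> * X)"
    using plus energy by (intro mult_left_mono) auto
  finally have *: "X * (h\<^sup>2 * X) \<le> X * (2 * \<Delta> * energy w)"
    by (simp add: power2_eq_square algebra_simps)
  show ?thesis
  proof (cases "X = 0")
    case False
    with X * show ?thesis unfolding X_def[symmetric] by simp
  next
    case True
    have "0 \<le> \<Delta> \<or> energy w = 0"
    proof (cases "W = {}")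
      case False
      then obtain a where "a \<in> W" by auto
      then have "0 \<le> \<Delta>" using degree[of a] sum_nonneg[of W "c a"] weight_nonneg by fastforce
      then show ?thesis ..
    qed (unfold energy_def, simp)
    with True energy show ?thesis unfolding X_def[symmetric] by auto
  qed
qed

lemma exists_median:
  fixes f :: "'a \<Rightarrow> real"
  assumes "W \<noteq> {}"
  shows "\<exists>r. 2 * card {a \<in> W. r < f a} \<le> card W \<and> 2 * card {a \<in> W. f a < r} \<le> card W"
proof -
  define U where "U = {x \<in> f ` W. 2 * card {a \<in> W. x < f a} \<le> card W}"
  define r where "r = Min U"
  have fin: "finite U" unfolding U_def using finite_nodes by simp
  have "Max (f ` W) \<in> U"
  proof -
    have empty: "{a \<in> W. Max (f ` W) < f a} = {}"
      using finite_nodes by (auto simp: not_less)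
    have "2 * card {a \<in> W. Max (f ` W) < f a} \<le> card W" unfolding empty by simp
    moreover have "Max (f ` W) \<in> f ` W" using finite_nodes assms by (intro Max_in) auto
    ultimately show ?thesis unfolding U_def by (intro CollectI conjI)
  qed
  then have r: "r \<in> U" unfolding r_def using fin by (intro Min_in) auto
  have "2 * card {a \<in> W. f a < r} \<le> card W"
  proof (cases "{a \<in> W. f a < r} = {}")
    case False
    define L where "L = {a \<in> W. f a < r}"
    have L: "finite L" "L \<noteq> {}" using False finite_nodes unfolding L_def by auto
    define q where "q = Max (f ` L)"
    have "q \<in> f ` L" unfolding q_def using L by (intro Max_in) auto
    then have q: "q < r" "q \<in> f ` W" unfolding L_def by auto
    have "q \<notin> U" using q(1) fin unfolding r_def by (meson Min_le leD)
    then have big: "card W < 2 * card {a \<in> W. q < f a}" using q(2) unfolding U_def by simp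
    have "L \<inter> {a \<in> W. q < f a} = {}"
      using L unfolding q_def by (auto simp: not_less)
    then have "card L + card {a \<in> W. q < f a} = card (L \<union> {a \<in> W. q < f a})"
      using L finite_nodes by (simp add: card_Un_disjoint)
    also have "\<dots> \<le> card W"
      unfolding L_def using finite_nodes by (intro card_mono) auto
    finally show ?thesis using big unfolding L_def by simp
  qed (simp only: card.empty mult_0_right le0)
  then show ?thesis using r unfolding U_def by blast
qed

text \<open>Shifting \<open>f\<close> by a median \<open>r\<close> makes the supports of the positive and the negative part of \<open>f - r\<close>
  small enough for \<open>cheeger_small_support\<close>. As \<open>f\<close> has mean zero, the shift can only increase the norm,
  and the energies of the two parts add up to at most the energy of \<open>f\<close>.\<close>

lemma cheeger_inequality:
  fixes h :: real
  assumes h: "0 \<le> h"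
    and expand: "\<And>T. T \<subseteq> W \<Longrightarrow> 2 * card T \<le> card W \<Longrightarrow> h * card T \<le> cut T"
    and degree: "\<And>a. a \<in> W \<Longrightarrow> (\<Sum>b\<in>W. c a b) \<le> \<Delta>"
    and mean_zero: "(\<Sum>a\<in>W. f a) = 0"
  shows "h\<^sup>2 * (\<Sum>a\<in>W. (f a)\<^sup>2) \<le> 2 * \<Delta> * energy f"
proof (cases "W = {}")
  case True
  then have "energy f = 0" unfolding energy_def by simp
  with True show ?thesis by simp
next
  case False
  obtain r where r: "2 * card {a \<in> W. r < f a} \<le> card W" "2 * card {a \<in> W. f a < r} \<le> card W"
    using exists_median[OF False] by blast
  define u v where "u a = max (f a - r) 0" and "v a = max (r - f a) 0" for a
  have "\<Delta> \<ge> 0"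
  proof -
    obtain a where "a \<in> W" using False by auto
    then show "0 \<le> \<Delta>" using degree[of a] sum_nonneg[of W "c a"] weight_nonneg by fastforce
  qed
  \<comment> \<open>the term that is subtracted vanishes; it completes the square\<close>
  have "(\<Sum>a\<in>W. (f a)\<^sup>2) \<le> (\<Sum>a\<in>W. (f a)\<^sup>2 + r\<^sup>2) - 2 * r * (\<Sum>a\<in>W. f a)"
    using mean_zero by (simp add: sum_mono)
  also have "\<dots> = (\<Sum>a\<in>W. (f a - r)\<^sup>2)"
    by (simp add: power2_diff sum.distrib sum_subtractf sum_distrib_left sum_distrib_right mult_ac)
  also have "\<dots> = (\<Sum>a\<in>W. (u a)\<^sup>2) + (\<Sum>a\<in>W. (v a)\<^sup>2)"
    unfolding sum.distrib[symmetric]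
    by (intro sum.cong refl) (auto simp: u_def v_def max_def power2_commute)
  finally have "h\<^sup>2 * (\<Sum>a\<in>W. (f a)\<^sup>2) \<le> h\<^sup>2 * (\<Sum>a\<in>W. (u a)\<^sup>2) + h\<^sup>2 * (\<Sum>a\<in>W. (v a)\<^sup>2)"
    by (metis distrib_left mult_left_mono zero_le_power2)
  also have "\<dots> \<le> 2 * \<Delta> * energy u + 2 * \<Delta> * energy v"
    using r by (intro add_mono cheeger_small_support[OF h expand degree])
      (auto simp: u_def v_def less_max_iff_disj)
  also have "energy u + energy v \<le> energy f"
  proof -
    have "(u a - u b)\<^sup>2 + (v a - v b)\<^sup>2 \<le> (f a - f b)\<^sup>2" for a b
    proof -
      have split: "f x - r = u x - v x" and disj: "u x * v x = 0" and pos: "0 \<le> u x" "0 \<le> v x" for x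
        unfolding u_def v_def by (auto simp: max_def)
      have "f a - f b = (u a - u b) - (v a - v b)"
        using split[of a] split[of b] by linarith
      then have "(f a - f b)\<^sup>2 = ((u a - u b) - (v a - v b))\<^sup>2" by simp
      also have "\<dots> = (u a - u b)\<^sup>2 + (v a - v b)\<^sup>2 - 2 * (u a * v a + u b * v b)
          + 2 * (u a * v b + u b * v a)"
        by (simp add: power2_eq_square algebra_simps)
      also have "\<dots> \<ge> (u a - u b)\<^sup>2 + (v a - v b)\<^sup>2"
        unfolding disj[of a] disj[of b] by (simp add: pos)
      finally show ?thesis .
    qed
    then have "(\<Sum>a\<in>W. \<Sum>b\<in>W. c a b * ((u a - u b)\<^sup>2 + (v a - v b)\<^sup>2))
        \<le> (\<Sum>a\<in>W. \<Sum>b\<in>W. c a b * (f a - f b)\<^sup>2)"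
      by (intro sum_mono mult_left_mono weight_nonneg)
    then show ?thesis
      unfolding energy_def by (simp add: distrib_left sum.distrib)
  qed
  then have "2 * \<Delta> * energy u + 2 * \<Delta> * energy v \<le> 2 * \<Delta> * energy f"
    using \<open>\<Delta> \<ge> 0\<close> by (metis distrib_left mult_left_mono mult_nonneg_nonneg zero_le_numeral)
  finally show ?thesis .
qed

text \<open>With \<open>f = \<mu> + g\<close> and \<open>g\<close> of mean zero, the claim reduces to the nonnegativity of
  \<open>\<tau> G + 2 \<mu> B + \<beta> \<mu>\<^sup>2 m / \<tau>\<close>, where \<open>\<tau> = \<Lambda> - \<alpha>\<close>, \<open>m\<close> is the number of nodes, \<open>G\<close> is the squared
  norm of \<open>g\<close> and \<open>B\<close> is the scalar product of \<open>d\<close> and \<open>g\<close>. Since \<open>B\<^sup>2 \<le> \<beta> m G\<close>, this is a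
  completed square.\<close>

lemma grounded_form_lower_bound:
  fixes d f :: "'a \<Rightarrow> real" and \<alpha> \<beta> \<Lambda> :: real
  assumes gap: "\<And>g. (\<Sum>a\<in>W. g a) = 0 \<Longrightarrow> \<Lambda> * (\<Sum>a\<in>W. (g a)\<^sup>2) \<le> energy g"
    and d_nonneg: "\<And>a. a \<in> W \<Longrightarrow> 0 \<le> d a"
    and d_sum: "\<alpha> * card W \<le> (\<Sum>a\<in>W. d a)"
    and d_square_sum: "(\<Sum>a\<in>W. (d a)\<^sup>2) \<le> \<beta> * card W"
    and less: "\<alpha> < \<Lambda>"
  shows "(\<alpha> - \<beta> / (\<Lambda> - \<alpha>)) * (\<Sum>a\<in>W. (f a)\<^sup>2) \<le> energy f + (\<Sum>a\<in>W. d a * (f a)\<^sup>2)"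
proof (cases "W = {}")
  case True
  then have "energy f = 0" unfolding energy_def by simp
  with True show ?thesis by simp
next
  case False
  then have m: "card W > 0" using finite_nodes by auto
  define \<mu> where "\<mu> = (\<Sum>a\<in>W. f a) / card W"
  define g where "g a = f a - \<mu>" for a
  define G where "G = (\<Sum>a\<in>W. (g a)\<^sup>2)"
  define B where "B = (\<Sum>a\<in>W. d a * g a)"
  define \<tau> where "\<tau> = \<Lambda> - \<alpha>"
  have \<tau>: "\<tau> > 0" unfolding \<tau>_def using less by simp
  have f: "f a = \<mu> + g a" for a unfolding g_def by simp
  have g0: "(\<Sum>a\<in>W. g a) = 0"
    unfolding g_def \<mu>_def using m by (simp add: sum_subtractf)
  have energy: "\<Lambda> * G \<le> energy f"
    using gap[OF g0] energy_shift[of f \<mu>] unfolding g_def G_def by simp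
  have f2: "(\<Sum>a\<in>W. (f a)\<^sup>2) = \<mu>\<^sup>2 * card W + G"
  proof -
    have "(\<Sum>a\<in>W. (f a)\<^sup>2) = (\<Sum>a\<in>W. \<mu>\<^sup>2) + 2 * \<mu> * (\<Sum>a\<in>W. g a) + G"
      unfolding f G_def by (simp add: power2_sum sum.distrib sum_distrib_left sum_distrib_right mult_ac)
    then show ?thesis using g0 by simp
  qed
  have "(\<Sum>a\<in>W. d a * (f a)\<^sup>2) = \<mu>\<^sup>2 * (\<Sum>a\<in>W. d a) + 2 * \<mu> * B + (\<Sum>a\<in>W. d a * (g a)\<^sup>2)"
    unfolding f B_def
    by (simp add: power2_sum sum.distrib sum_distrib_left sum_distrib_right distrib_left mult_ac)
  moreover have "\<mu>\<^sup>2 * (\<alpha> * card W) \<le> \<mu>\<^sup>2 * (\<Sum>a\<in>W. d a)"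
    using d_sum by (intro mult_left_mono) auto
  moreover have "0 \<le> (\<Sum>a\<in>W. d a * (g a)\<^sup>2)"
    using d_nonneg by (intro sum_nonneg) auto
  ultimately have form: "\<mu>\<^sup>2 * (\<alpha> * card W) + 2 * \<mu> * B \<le> (\<Sum>a\<in>W. d a * (f a)\<^sup>2)"
    by linarith
  have "B\<^sup>2 \<le> (\<Sum>a\<in>W. (d a)\<^sup>2) * G"
    unfolding B_def G_def by (rule Cauchy_Schwarz_ineq_sum)
  also have "\<dots> \<le> \<beta> * card W * G"
    using d_square_sum by (intro mult_right_mono) (auto simp: G_def sum_nonneg)
  finally have B: "B\<^sup>2 \<le> \<beta> * card W * G" .
  have G: "G \<ge> 0" unfolding G_def by (simp add: sum_nonneg)
  have \<beta>: "\<beta> \<ge> 0"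
    using d_square_sum m sum_nonneg[of W "\<lambda>a. (d a)\<^sup>2"] by (smt (verit) mult_neg_pos of_nat_0_less_iff zero_le_power2)
  have main: "0 \<le> \<tau> * G + 2 * \<mu> * B + \<beta> / \<tau> * (\<mu>\<^sup>2 * card W)"
  proof (cases "G = 0")
    case True
    then have "B = 0" using B by simp
    then show ?thesis using True \<beta> \<tau> by simp
  next
    case False
    then have Gpos: "G > 0" using G by simp
    have "0 \<le> (\<tau> * G + \<mu> * B)\<^sup>2" by simp
    also have "\<dots> = \<tau> * G * (\<tau> * G + 2 * \<mu> * B) + \<mu>\<^sup>2 * B\<^sup>2"
      by (simp add: power2_eq_square algebra_simps)
    also have "\<dots> \<le> \<tau> * G * (\<tau> * G + 2 * \<mu> * B) + \<mu>\<^sup>2 * (\<beta> * card W * G)"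
      using B by (intro add_left_mono mult_left_mono) auto
    also have "\<dots> = \<tau> * G * (\<tau> * G + 2 * \<mu> * B + \<beta> / \<tau> * (\<mu>\<^sup>2 * card W))"
      using \<tau> by (simp add: field_simps)
    finally have "\<tau> * G * 0 \<le> \<tau> * G * (\<tau> * G + 2 * \<mu> * B + \<beta> / \<tau> * (\<mu>\<^sup>2 * card W))"
      by simp
    then show ?thesis using mult_le_cancel_left_pos[OF mult_pos_pos[OF \<tau> Gpos]] by blast
  qed
  have "(\<alpha> - \<beta> / \<tau>) * (\<Sum>a\<in>W. (f a)\<^sup>2)
      = \<alpha> * (\<mu>\<^sup>2 * card W) + \<alpha> * G - \<beta> / \<tau> * (\<mu>\<^sup>2 * card W) - \<beta> / \<tau> * G"
    unfolding f2 by (simp add: algebra_simps)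
  also have "\<dots> \<le> \<alpha> * (\<mu>\<^sup>2 * card W) + \<alpha> * G - \<beta> / \<tau> * (\<mu>\<^sup>2 * card W)"
    using \<beta> \<tau> G by simp
  also have "\<dots> \<le> \<alpha> * (\<mu>\<^sup>2 * card W) + \<alpha> * G + \<tau> * G + 2 * \<mu> * B"
    using main by linarith
  also have "\<dots> = \<Lambda> * G + (\<mu>\<^sup>2 * (\<alpha> * card W) + 2 * \<mu> * B)"
    unfolding \<tau>_def by (simp add: algebra_simps)
  also have "\<dots> \<le> energy f + (\<Sum>a\<in>W. d a * (f a)\<^sup>2)"
    using energy form by (intro add_mono)
  finally show ?thesis unfolding \<tau>_def .
qed

end

section \<open>The quadratic form of the grounded Laplacian\<close>

definition adjacent :: "nat set set \<Rightarrow> nat \<Rightarrow> nat \<Rightarrow> real" where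
  "adjacent E a b = of_bool ({a, b} \<in> E)"

lemma adjacent_weighted_graph: "finite W \<Longrightarrow> weighted_graph W (adjacent E)"
  by unfold_locales (auto simp: adjacent_def insert_commute)

lemma no_loops: "E \<subseteq> possible_edges n \<Longrightarrow> {a, a} \<notin> E"
  by (auto simp: possible_edges_def)

lemma degree_eq_sum_adjacent:
  assumes E: "E \<subseteq> possible_edges n" and "a < n"
  shows "real (card {e \<in> E. a \<in> e}) = (\<Sum>b<n. adjacent E a b)"
proof -
  have "bij_betw (\<lambda>b. {a, b}) {b \<in> {..<n}. {a, b} \<in> E} {e \<in> E. a \<in> e}"
    unfolding bij_betw_def
  proof
    show "inj_on (\<lambda>b. {a, b}) {b \<in> {..<n}. {a, b} \<in> E}"
      by (auto simp: inj_on_def doubleton_eq_iff)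
    have "e \<in> (\<lambda>b. {a, b}) ` {b \<in> {..<n}. {a, b} \<in> E}" if e: "e \<in> E" "a \<in> e" for e
    proof -
      have "e \<subseteq> {..<n}" "card e = 2" using e E by (auto simp: possible_edges_def)
      then obtain b where "e = {a, b}" "b < n"
        using e(2) by (auto simp: card_2_iff)
      with e show ?thesis by auto
    qed
    then show "(\<lambda>b. {a, b}) ` {b \<in> {..<n}. {a, b} \<in> E} = {e \<in> E. a \<in> e}" by auto
  qed
  then have "card {e \<in> E. a \<in> e} = card {b \<in> {..<n}. {a, b} \<in> E}"
    by (simp add: bij_betw_same_card)
  also have "real \<dots> = (\<Sum>b<n. adjacent E a b)"
    by (simp add: adjacent_def of_bool_def sum.If_cases Int_def)
  finally show ?thesis .
qed

lemma laplacian_entry: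
  assumes "E \<subseteq> possible_edges n" "a < n" "b < n"
  shows "laplacian n E $$ (a, b) = (if a = b then \<Sum>x<n. adjacent E a x else 0) - adjacent E a b"
proof -
  have "adjacent E a b = (if {a, b} \<in> E then 1 else 0)" by (simp add: adjacent_def)
  then show ?thesis
    using assms degree_eq_sum_adjacent[OF assms(1,2), symmetric]
    by (cases "a = b") (simp_all add: laplacian_def degree_matrix_def adjacency_matrix_def)
qed

text \<open>The rows of a submatrix are indexed by positions; this is the passage back to nodes.\<close>

lemma bij_betw_pick:
  assumes "finite W"
  shows "bij_betw (pick W) {..<card W} W"
proof -
  have inj: "inj_on (pick W) {..<card W}"
    by (rule linorder_inj_onI) (use pick_mono[of _ W] in \<open>force+\<close>)
  moreover have "pick W ` {..<card W} \<subseteq> W" using pick_in_set by auto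
  then have "pick W ` {..<card W} = W"
    using assms card_image[OF inj] by (intro card_subset_eq) auto
  ultimately show ?thesis by (simp add: bij_betw_def)
qed

context
  fixes n :: nat and E :: "nat set set" and S W :: "nat set"
  assumes E: "E \<subseteq> possible_edges n" and S: "S \<subseteq> {..<n}" and W: "W = {..<n} - S"
begin

interpretation weighted_graph W "adjacent E"
  using W by (intro adjacent_weighted_graph) simp

lemma dim_grounded_laplacian: "grounded_laplacian n E S \<in> carrier_mat (card W) (card W)"
proof -
  have "{i. i < n \<and> i \<in> {..<n} - S} = W" using W by auto
  then show ?thesis
    unfolding grounded_laplacian_def
    by (intro carrier_matI) (simp_all add: dim_submatrix laplacian_def degree_matrix_def adjacency_matrix_def)
qed

lemma grounded_laplacian_entry:
  assumes "i < card W" "j < card W"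
  shows "grounded_laplacian n E S $$ (i, j) = laplacian n E $$ (pick W i, pick W j)"
proof -
  have "{i. i < n \<and> i \<in> {..<n} - S} = W" using W by auto
  then show ?thesis
    using assms unfolding grounded_laplacian_def W[symmetric]
    by (subst submatrix_index) (simp_all add: W laplacian_def degree_matrix_def adjacency_matrix_def)
qed

lemma pick_node: "i < card W \<Longrightarrow> pick W i \<in> W" 
  using pick_in_set by blast

lemma grounded_laplacian_symmetric: "transpose_mat (grounded_laplacian n E S) = grounded_laplacian n E S"
  using dim_grounded_laplacian W pick_node
  by (intro eq_matI) (auto simp: grounded_laplacian_entry laplacian_entry[OF E] weight_sym)

lemma sum_pick: "(\<Sum>i<card W. g (pick W i)) = (\<Sum>a\<in>W. g a)"
  using finite_nodes by (intro sum.reindex_bij_betw bij_betw_pick)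

abbreviation node_vec :: "(nat \<Rightarrow> real) \<Rightarrow> real vec" where
  "node_vec f \<equiv> Matrix.vec (card W) (\<lambda>i. f (pick W i))"

lemma node_vec_norm: "node_vec f \<bullet> node_vec f = (\<Sum>a\<in>W. (f a)\<^sup>2)"
  using sum_pick[of "\<lambda>a. (f a)\<^sup>2"] by (simp add: scalar_prod_def power2_eq_square atLeast0LessThan)

lemma grounded_quadratic_form:
  "quadratic_form (grounded_laplacian n E S) (node_vec f)
     = energy f + (\<Sum>a\<in>W. (\<Sum>b\<in>S. adjacent E a b) * (f a)\<^sup>2)"
proof -
  define L where "L a b = laplacian n E $$ (a, b)" for a b
  have "quadratic_form (grounded_laplacian n E S) (node_vec f)
      = (\<Sum>i<card W. f (pick W i) * (\<Sum>j<card W. L (pick W i) (pick W j) * f (pick W j)))"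
    using dim_grounded_laplacian
    by (simp add: quadratic_form_def scalar_prod_def atLeast0LessThan grounded_laplacian_entry L_def)
  also have "\<dots> = (\<Sum>a\<in>W. f a * (\<Sum>b\<in>W. L a b * f b))"
    using sum_pick[of "\<lambda>b. L _ b * f b"] sum_pick[of "\<lambda>a. f a * (\<Sum>b\<in>W. L a b * f b)"] by simp
  also have "\<dots> = (\<Sum>a\<in>W. (\<Sum>x<n. adjacent E a x) * (f a)\<^sup>2 - (\<Sum>b\<in>W. adjacent E a b * f a * f b))"
  proof (intro sum.cong refl)
    fix a assume a: "a \<in> W"
    have "(\<Sum>b\<in>W. L a b * f b)
        = (\<Sum>b\<in>W. (if a = b then (\<Sum>x<n. adjacent E a x) * f b else 0) - adjacent E a b * f b)"
      using a W by (intro sum.cong refl) (auto simp: L_def laplacian_entry[OF E] left_diff_distrib)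
    also have "\<dots> = (\<Sum>x<n. adjacent E a x) * f a - (\<Sum>b\<in>W. adjacent E a b * f b)"
      using a finite_nodes by (simp add: sum_subtractf)
    finally show "f a * (\<Sum>b\<in>W. L a b * f b)
        = (\<Sum>x<n. adjacent E a x) * (f a)\<^sup>2 - (\<Sum>b\<in>W. adjacent E a b * f a * f b)"
      by (simp add: right_diff_distrib power2_eq_square sum_distrib_left mult_ac)
  qed
  also have "\<dots> = (\<Sum>a\<in>W. (\<Sum>b\<in>S. adjacent E a b) * (f a)\<^sup>2)
      + ((\<Sum>a\<in>W. \<Sum>b\<in>W. adjacent E a b * (f a)\<^sup>2) - (\<Sum>a\<in>W. \<Sum>b\<in>W. adjacent E a b * f a * f b))"
  proof -
    have "(\<Sum>x<n. adjacent E a x) = (\<Sum>b\<in>S. adjacent E a b) + (\<Sum>b\<in>W. adjacent E a b)" for a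
      unfolding W using S by (simp add: sum.subset_diff add.commute)
    then show ?thesis
      by (simp add: distrib_right sum.distrib sum_subtractf sum_distrib_right)
  qed
  also have "(\<Sum>a\<in>W. \<Sum>b\<in>W. adjacent E a b * (f a)\<^sup>2) - (\<Sum>a\<in>W. \<Sum>b\<in>W. adjacent E a b * f a * f b)
      = energy f"
  proof -
    have "(\<Sum>a\<in>W. \<Sum>b\<in>W. adjacent E a b * (f b)\<^sup>2) = (\<Sum>a\<in>W. \<Sum>b\<in>W. adjacent E a b * (f a)\<^sup>2)"
      by (subst sum.swap) (simp add: weight_sym)
    moreover have "2 * energy f = (\<Sum>a\<in>W. \<Sum>b\<in>W. adjacent E a b * (f a)\<^sup>2
        + adjacent E a b * (f b)\<^sup>2 - 2 * (adjacent E a b * f a * f b))"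
      unfolding energy_def by (simp add: power2_diff algebra_simps)
    ultimately show ?thesis by (simp add: sum.distrib sum_subtractf sum_distrib_left[symmetric])
  qed
  finally show ?thesis by simp
qed

text \<open>The constant function is the test vector.\<close>

lemma smallest_eigenvalue_upper:
  assumes "W \<noteq> {}"
  shows "smallest_eigenvalue (grounded_laplacian n E S) * card W \<le> (\<Sum>a\<in>W. \<Sum>b\<in>S. adjacent E a b)"
proof -
  have m: "card W > 0" using assms finite_nodes by auto
  have "energy (\<lambda>_. 1) = 0" by (simp add: energy_def)
  then show ?thesis
    using rayleigh_minimum_attained(2)[OF dim_grounded_laplacian grounded_laplacian_symmetric m,
        of "node_vec (\<lambda>_. 1)"] node_vec_norm[of "\<lambda>_. 1"] grounded_quadratic_form[of "\<lambda>_. 1"]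
    by simp
qed

text \<open>Cheeger's inequality provides the spectral gap \<open>h\<^sup>2 / (2 \<Delta>)\<close> for
  \<open>grounded_form_lower_bound\<close>.\<close>

lemma smallest_eigenvalue_lower:
  fixes h \<Delta> \<alpha> \<beta> :: real
  assumes "W \<noteq> {}"
    and h: "0 \<le> h" and \<Delta>: "0 < \<Delta>"
    and expand: "\<And>T. T \<subseteq> W \<Longrightarrow> 2 * card T \<le> card W \<Longrightarrow>
      h * card T \<le> (\<Sum>a\<in>T. \<Sum>b\<in>W - T. adjacent E a b)"
    and degree: "\<And>a. a \<in> W \<Longrightarrow> (\<Sum>b\<in>W. adjacent E a b) \<le> \<Delta>"
    and boundary: "\<alpha> * card W \<le> (\<Sum>a\<in>W. \<Sum>b\<in>S. adjacent E a b)"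
    and boundary_squares: "(\<Sum>a\<in>W. (\<Sum>b\<in>S. adjacent E a b)\<^sup>2) \<le> \<beta> * card W"
    and less: "\<alpha> < h\<^sup>2 / (2 * \<Delta>)"
  shows "\<alpha> - \<beta> / (h\<^sup>2 / (2 * \<Delta>) - \<alpha>) \<le> smallest_eigenvalue (grounded_laplacian n E S)"
proof (rule smallest_eigenvalue_ge[OF dim_grounded_laplacian grounded_laplacian_symmetric])
  show "card W > 0" using assms(1) finite_nodes by auto
  fix v :: "real vec" assume v: "v \<in> carrier_vec (card W)"
  \<comment> \<open>the vector is turned back into a function on the nodes\<close>
  define f where "f = (\<lambda>a. v $ (inv_into {..<card W} (pick W) a))"
  have inj: "inj_on (pick W) {..<card W}"
    using bij_betw_pick[OF finite_nodes] by (simp add: bij_betw_def)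
  have v_eq: "v = node_vec f"
    using v inj by (intro eq_vecI) (auto simp: f_def inv_into_f_f)
  have gap: "h\<^sup>2 / (2 * \<Delta>) * (\<Sum>a\<in>W. (g a)\<^sup>2) \<le> energy g" if "(\<Sum>a\<in>W. g a) = 0" for g
    using cheeger_inequality[OF h expand[folded cut_def] degree that] \<Delta> by (simp add: field_simps)
  show "(\<alpha> - \<beta> / (h\<^sup>2 / (2 * \<Delta>) - \<alpha>)) * (v \<bullet> v) \<le> quadratic_form (grounded_laplacian n E S) v"
    unfolding v_eq node_vec_norm grounded_quadratic_form
    using gap boundary boundary_squares less
    by (intro grounded_form_lower_bound) (auto simp: sum_nonneg weight_nonneg)
qed

end

section \<open>Binomial tails and moments\<close>

lemma binomial_exp_moment:
  assumes p: "p \<in> {0..1}"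
  shows "measure_pmf.expectation (binomial_pmf N p) (\<lambda>k. exp (\<theta> * real k)) \<le> exp (real N * p * (exp \<theta> - 1))"
proof -
  have "measure_pmf.expectation (binomial_pmf N p) (\<lambda>k. exp (\<theta> * real k))
      = (\<Sum>k\<le>N. real (N choose k) * (p * exp \<theta>) ^ k * (1 - p) ^ (N - k))"
    unfolding expectation_binomial_pmf'[OF p]
    by (intro sum.cong refl) (simp add: power_mult_distrib exp_of_nat2_mult mult_ac)
  also have "\<dots> = (p * exp \<theta> + (1 - p)) ^ N"
    by (rule binomial_ring[symmetric])
  also have "\<dots> \<le> exp (p * (exp \<theta> - 1)) ^ N"
  proof (rule power_mono)
    show "p * exp \<theta> + (1 - p) \<le> exp (p * (exp \<theta> - 1))"
      using exp_ge_add_one_self[of "p * (exp \<theta> - 1)"] by (simp add: algebra_simps)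
    show "0 \<le> p * exp \<theta> + (1 - p)"
      using p by (intro add_nonneg_nonneg mult_nonneg_nonneg) auto
  qed
  also have "\<dots> = exp (real N * p * (exp \<theta> - 1))"
    by (simp add: exp_of_nat_mult[symmetric] mult_ac)
  finally show ?thesis .
qed

text \<open>Both tails in one statement: positive \<open>\<theta>\<close> gives the upper tail and negative \<open>\<theta>\<close> the lower one.\<close>

lemma chernoff_bound_binomial:
  assumes p: "p \<in> {0..1}"
  shows "measure_pmf.prob (binomial_pmf N p) {k. b \<le> \<theta> * real k} \<le> exp (real N * p * (exp \<theta> - 1) - b)"
proof -
  have "measure_pmf.prob (binomial_pmf N p) {k. b \<le> \<theta> * real k}
      = measure_pmf.prob (binomial_pmf N p) {k \<in> space (measure_pmf (binomial_pmf N p)). exp b \<le> exp (\<theta> * real k)}"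
    by simp
  also have "\<dots> \<le> measure_pmf.expectation (binomial_pmf N p) (\<lambda>k. exp (\<theta> * real k)) / exp b"
    by (rule integral_Markov_inequality_measure[where A = "{}"]) (use p in auto)
  also have "\<dots> \<le> exp (real N * p * (exp \<theta> - 1)) / exp b"
    using binomial_exp_moment[OF p] by (intro divide_right_mono) auto
  finally show ?thesis by (simp add: exp_diff)
qed

lemma binomial_first_moment:
  assumes p: "p \<in> {0..1}"
  shows "measure_pmf.expectation (binomial_pmf N p) real = real N * p"
proof -
  have "measure_pmf.expectation (binomial_pmf N p) real = (\<Sum>k\<le>N. real k * Bernstein N k p)"
    unfolding expectation_binomial_pmf'[OF p] by (simp add: Bernstein_def mult_ac)
  then show ?thesis by simp
qed

lemma binomial_second_moment:
  assumes p: "p \<in> {0..1}"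
  shows "measure_pmf.expectation (binomial_pmf N p) (\<lambda>k. (real k)\<^sup>2) = real N * p * (1 - p) + (real N * p)\<^sup>2"
proof -
  have "measure_pmf.expectation (binomial_pmf N p) (\<lambda>k. (real k)\<^sup>2)
      = (\<Sum>k\<le>N. real k * (real k - 1) * Bernstein N k p + real k * Bernstein N k p)"
    unfolding expectation_binomial_pmf'[OF p]
    by (simp add: Bernstein_def power2_eq_square algebra_simps)
  also have "\<dots> = real N * p * (1 - p) + (real N * p)\<^sup>2"
    by (simp only: sum.distrib sum_kk_Bernstein sum_k_Bernstein)
      (simp add: power2_eq_square algebra_simps)
  finally show ?thesis .
qed

lemma chebyshev_binomial:
  assumes p: "p \<in> {0..1}" and r: "r > 0"
  shows "measure_pmf.prob (binomial_pmf N p) {k. r \<le> \<bar>real k - real N * p\<bar>} \<le> real N * p / r\<^sup>2"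
proof -
  define M where "M = measure_pmf (binomial_pmf N p)"
  have int: "integrable M f" for f :: "nat \<Rightarrow> real" unfolding M_def using p by simp
  have "measure M {k. r \<le> \<bar>real k - real N * p\<bar>}
      = measure M {k \<in> space M. r\<^sup>2 \<le> (real k - real N * p)\<^sup>2}"
    using r by (simp add: M_def abs_le_square_iff[symmetric])
  also have "\<dots> \<le> integral\<^sup>L M (\<lambda>k. (real k - real N * p)\<^sup>2) / r\<^sup>2"
    by (rule integral_Markov_inequality_measure[where A = "{}"]) (use r int in \<open>auto simp: M_def\<close>)
  also have "integral\<^sup>L M (\<lambda>k. (real k - real N * p)\<^sup>2)
      = integral\<^sup>L M (\<lambda>k. (real k)\<^sup>2) - 2 * (real N * p) * integral\<^sup>L M real + (real N * p)\<^sup>2"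
    using int by (simp add: power2_diff M_def mult_ac)
  also have "\<dots> = real N * p * (1 - p)"
    unfolding M_def binomial_first_moment[OF p] binomial_second_moment[OF p]
    by (simp add: power2_eq_square)
  also have "\<dots> \<le> real N * p" using p by (simp add: mult_left_le)
  finally show ?thesis unfolding M_def using r by (simp add: divide_right_mono)
qed


section \<open>Edge counts of the random graph\<close>

text \<open>Pairs are ordered, so this is the number of edges between \<open>A\<close> and \<open>B\<close> when these are disjoint.\<close>

definition edge_count :: "nat set set \<Rightarrow> nat set \<Rightarrow> nat set \<Rightarrow> nat" where
  "edge_count E A B = card {(a, b) \<in> A \<times> B. {a, b} \<in> E}"

lemma finite_possible_edges: "finite (possible_edges n)"
  by (rule finite_subset[of _ "Pow {..<n}"]) (auto simp: possible_edges_def)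

lemma set_pmf_erdos_renyi: "set_pmf (erdos_renyi n p) \<subseteq> Pow (possible_edges n)"
  by (auto simp: erdos_renyi_def)

lemma finite_set_pmf_erdos_renyi: "finite (set_pmf (erdos_renyi n p))"
  using set_pmf_erdos_renyi finite_possible_edges by (metis finite_Pow_iff finite_subset)

text \<open>Disjointness makes the unordered pairs \<open>{a, b}\<close> distinct possible edges, so the count is a number
  of successes in independent coin tosses.\<close>

lemma edge_count_binomial:
  assumes A: "A \<subseteq> {..<n}" and B: "B \<subseteq> {..<n}" and disj: "A \<inter> B = {}" and p: "p \<in> {0..1}"
  shows "map_pmf (\<lambda>E. edge_count E A B) (erdos_renyi n p) = binomial_pmf (card A * card B) p"
proof -
  define F where "F = (\<lambda>(a, b). {a, b}) ` (A \<times> B)"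
  have inj: "inj_on (\<lambda>(a, b). {a, b}) (A \<times> B)"
    using disj by (auto simp: inj_on_def doubleton_eq_iff)
  have F: "F \<subseteq> possible_edges n"
  proof -
    have "card {a, b} = 2" if "a \<in> A" "b \<in> B" for a b
      using that disj by (cases "a = b") auto
    then show ?thesis using A B by (auto simp: F_def possible_edges_def)
  qed
  have count: "edge_count {e \<in> possible_edges n. X e} A B = card {e \<in> F. X e}" for X
  proof -
    have "{e \<in> F. X e} = (\<lambda>(a, b). {a, b}) ` {(a, b) \<in> A \<times> B. {a, b} \<in> {e \<in> possible_edges n. X e}}"
      using F by (auto simp: F_def)
    moreover have "inj_on (\<lambda>(a, b). {a, b}) {(a, b) \<in> A \<times> B. {a, b} \<in> {e \<in> possible_edges n. X e}}"
      by (rule inj_on_subset[OF inj]) auto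
    ultimately show ?thesis by (simp only: edge_count_def card_image)
  qed
  have "card F = card A * card B"
    using card_image[OF inj] by (simp add: F_def card_cartesian_product)
  moreover have "finite F" using F finite_possible_edges by (rule finite_subset)
  ultimately have "binomial_pmf (card A * card B) p
      = map_pmf (\<lambda>X. card {e \<in> F. X e}) (Pi_pmf F False (\<lambda>_. bernoulli_pmf p))"
    using p by (intro binomial_pmf_altdef')
  also have "\<dots> = map_pmf (\<lambda>X. card {e \<in> F. X e})
      (Pi_pmf (possible_edges n) False (\<lambda>_. bernoulli_pmf p))"
    unfolding Pi_pmf_subset[OF finite_possible_edges F] map_pmf_comp
    by (intro map_pmf_cong refl arg_cong[where f = card]) auto
  also have "\<dots> = map_pmf (\<lambda>E. edge_count E A B) (erdos_renyi n p)"
    unfolding erdos_renyi_def map_pmf_comp count ..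
  finally show ?thesis ..
qed


lemma edge_count_eq_sum:
  assumes "finite A" "finite B"
  shows "real (edge_count E A B) = (\<Sum>a\<in>A. \<Sum>b\<in>B. adjacent E a b)"
proof -
  have "(\<Sum>a\<in>A. \<Sum>b\<in>B. adjacent E a b) = (\<Sum>x\<in>A \<times> B. of_bool (case x of (a, b) \<Rightarrow> {a, b} \<in> E))"
    unfolding sum.cartesian_product adjacent_def by (intro sum.cong) auto
  also have "\<dots> = real (card {x \<in> A \<times> B. case x of (a, b) \<Rightarrow> {a, b} \<in> E})"
    using assms by (simp add: of_bool_def sum.If_cases Int_def)
  also have "{x \<in> A \<times> B. case x of (a, b) \<Rightarrow> {a, b} \<in> E} = {(a, b) \<in> A \<times> B. {a, b} \<in> E}"
    by auto
  finally show ?thesis by (simp add: edge_count_def)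
qed

lemma degree_eq_edge_count:
  assumes E: "E \<subseteq> possible_edges n" and "finite W" "a \<in> W"
  shows "(\<Sum>b\<in>W. adjacent E a b) = real (edge_count E {a} (W - {a}))"
proof -
  have "adjacent E a a = 0" using no_loops[OF E, of a] by (simp add: adjacent_def)
  then have "(\<Sum>b\<in>W. adjacent E a b) = (\<Sum>b\<in>W - {a}. adjacent E a b)"
    using assms(2,3) by (simp add: sum.remove)
  then show ?thesis using assms(2) by (simp add: edge_count_eq_sum)
qed

lemma prob_edge_count:
  assumes "A \<subseteq> {..<n}" "B \<subseteq> {..<n}" "A \<inter> B = {}" "p \<in> {0..1}"
  shows "measure_pmf.prob (erdos_renyi n p) {E. Q (edge_count E A B)}
    = measure_pmf.prob (binomial_pmf (card A * card B) p) {k. Q k}"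
  unfolding edge_count_binomial[OF assms, symmetric] by (simp add: vimage_def)

lemma prob_exists_le:
  assumes "finite I"
  shows "measure_pmf.prob M {x. \<exists>i\<in>I. Q i x} \<le> (\<Sum>i\<in>I. measure_pmf.prob M {x. Q i x})"
proof -
  have "{x. \<exists>i\<in>I. Q i x} = (\<Union>i\<in>I. {x. Q i x})" by auto
  then show ?thesis
    using measure_pmf.finite_measure_subadditive_finite[OF assms, of "\<lambda>i. {x. Q i x}" M] by simp
qed

lemma prob_disj_le:
  "measure_pmf.prob M {x. P x \<or> Q x} \<le> measure_pmf.prob M {x. P x} + measure_pmf.prob M {x. Q x}"
  using measure_Un_le[of "{x. P x}" "measure_pmf M" "{x. Q x}"] by (simp add: Collect_disj_eq)

lemma sum_power_card_subsets:
  fixes y :: real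
  assumes "finite W"
  shows "(\<Sum>T\<in>Pow W. y ^ card T) = (1 + y) ^ card W"
  using prod_add[OF assms, of "\<lambda>_. y" "\<lambda>_. 1"] by (simp add: add.commute)

section \<open>Expansion, degrees and boundary of the random graph\<close>

text \<open>Union bound over \<open>T\<close>. With \<open>\<kappa> = 1 - exp (-t)\<close>, the Chernoff bound for a set of size \<open>k\<close> is
  \<open>exp (k (t h - (m - k) p \<kappa>))\<close>. For \<open>k \<le> \<epsilon> m\<close> this is at most \<open>y ^ k\<close> with \<open>y = exp (-A) / m\<close>, and
  by the binomial theorem these terms add up to at most \<open>(1 + y) ^ m - 1\<close>. For larger \<open>k \<le> m / 2\<close> only
  \<open>m - k \<ge> m / 2\<close> is available, but each term is at most \<open>exp (- \<epsilon> m B)\<close>, which pays for all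
  \<open>2 ^ m\<close> sets.\<close>

lemma prob_expansion_fails:
  fixes t h \<epsilon> A B p :: real
  assumes W: "W \<subseteq> {..<n}" "W \<noteq> {}" and p: "p \<in> {0..1}" and t: "0 \<le> t"
    and \<epsilon>: "0 \<le> \<epsilon>" and B: "0 \<le> B"
    and small: "ln (card W) + A \<le> (1 - \<epsilon>) * card W * p * (1 - exp (-t)) - t * h"
    and large: "B \<le> card W * p * (1 - exp (-t)) / 2 - t * h"
  shows "measure_pmf.prob (erdos_renyi n p)
      {E. \<exists>T\<in>{T. T \<subseteq> W \<and> T \<noteq> {} \<and> 2 * card T \<le> card W}. edge_count E T (W - T) \<le> h * card T}
    \<le> (exp (exp (-A)) - 1) + 2 ^ card W * exp (- (\<epsilon> * card W * B))"
proof -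
  define m where "m = card W"
  define \<kappa> where "\<kappa> = 1 - exp (-t)"
  define y where "y = exp (- (ln m + A))"
  have fin: "finite W" using W finite_subset by auto
  have m: "m > 0" unfolding m_def using W fin by auto
  have \<kappa>: "\<kappa> \<ge> 0" unfolding \<kappa>_def using t by simp
  let ?P = "\<lambda>T. measure_pmf.prob (erdos_renyi n p) {E. edge_count E T (W - T) \<le> h * card T}"
  define I where "I = {T. T \<subseteq> W \<and> T \<noteq> {} \<and> 2 * card T \<le> card W}"
  have finI: "finite I" unfolding I_def using fin by auto
  have single: "?P T \<le> exp (real (card T) * (t * h - (real m - card T) * p * \<kappa>))" if T: "T \<subseteq> W" for T
  proof -
    have "card (W - T) = m - card T" "card T \<le> m"
      using T fin by (auto simp: m_def card_Diff_subset finite_subset card_mono)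
    then have diff: "real (card (W - T)) = real m - real (card T)" by simp
    have "?P T = measure_pmf.prob (binomial_pmf (card T * card (W - T)) p) {k. real k \<le> h * card T}"
      using T W by (intro prob_edge_count p) auto
    also have "\<dots> \<le> measure_pmf.prob (binomial_pmf (card T * card (W - T)) p)
        {k. - t * (h * card T) \<le> - t * real k}"
      using t by (intro measure_pmf.finite_measure_mono) (auto intro: mult_left_mono)
    also have "\<dots> \<le> exp (real (card T * card (W - T)) * p * (exp (-t) - 1) - - t * (h * card T))"
      by (rule chernoff_bound_binomial[OF p])
    also have "\<dots> = exp (real (card T) * (t * h - (real m - card T) * p * \<kappa>))"
      unfolding of_nat_mult diff by (simp add: \<kappa>_def algebra_simps)
    finally show ?thesis .
  qed
  have each: "?P T \<le> y ^ card T + exp (- (\<epsilon> * m * B))" if "T \<in> I" for T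
  proof -
    have T: "T \<subseteq> W" "2 * card T \<le> m" using that by (auto simp: I_def m_def)
    have p\<kappa>: "p * \<kappa> \<ge> 0" using p \<kappa> by simp
    show ?thesis
    proof (cases "card T \<le> \<epsilon> * m")
      case True
      have "t * h - (real m - card T) * p * \<kappa> \<le> t * h - (1 - \<epsilon>) * m * p * \<kappa>"
        using mult_right_mono[OF _ p\<kappa>, of "(1 - \<epsilon>) * m" "real m - card T"] True
        by (simp add: algebra_simps)
      also have "\<dots> \<le> - (ln m + A)"
        using small by (simp add: m_def \<kappa>_def)
      finally have "real (card T) * (t * h - (real m - card T) * p * \<kappa>) \<le> real (card T) * - (ln m + A)"
        by (intro mult_left_mono) auto
      then have "?P T \<le> exp (real (card T) * - (ln m + A))"
        using single[OF T(1)] by (meson exp_le_cancel_iff order.trans)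
      also have "\<dots> = y ^ card T" by (simp only: y_def exp_of_nat_mult)
      finally show ?thesis by (simp add: add_increasing2)
    next
      case False
      have "t * h - (real m - card T) * p * \<kappa> \<le> t * h - m / 2 * p * \<kappa>"
        using mult_right_mono[OF _ p\<kappa>, of "m / 2" "real m - card T"] T(2)
        by (simp add: algebra_simps)
      also have "\<dots> \<le> - B" using large by (simp add: m_def \<kappa>_def)
      finally have "real (card T) * (t * h - (real m - card T) * p * \<kappa>) \<le> real (card T) * - B"
        by (intro mult_left_mono) auto
      also have "\<dots> \<le> - (\<epsilon> * m * B)"
        using False B by (simp add: mult_right_mono)
      finally have "?P T \<le> exp (- (\<epsilon> * m * B))"
        using single[OF T(1)] by (meson exp_le_cancel_iff order.trans)
      then show ?thesis by (simp add: add_increasing y_def)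
    qed
  qed
  have "measure_pmf.prob (erdos_renyi n p) {E. \<exists>T\<in>I. edge_count E T (W - T) \<le> h * card T} \<le> (\<Sum>T\<in>I. ?P T)"
    by (rule prob_exists_le[OF finI])
  also have "\<dots> \<le> (\<Sum>T\<in>I. y ^ card T) + (\<Sum>T\<in>I. exp (- (\<epsilon> * m * B)))"
    unfolding sum.distrib[symmetric] by (intro sum_mono each)
  also have "(\<Sum>T\<in>I. y ^ card T) \<le> exp (exp (-A)) - 1"
  proof -
    have "(\<Sum>T\<in>I. y ^ card T) \<le> (\<Sum>T\<in>Pow W - {{}}. y ^ card T)"
      using fin by (intro sum_mono2) (auto simp: I_def y_def)
    also have "\<dots> = (\<Sum>T\<in>Pow W. y ^ card T) - 1"
      using fin by (subst sum_diff1) auto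
    also have "\<dots> = (1 + y) ^ m - 1"
      unfolding m_def by (simp add: sum_power_card_subsets[OF fin])
    also have "(1 + y) ^ m \<le> exp y ^ m"
      by (intro power_mono) (auto simp: y_def)
    also have "exp y ^ m = exp (m * y)" by (simp add: exp_of_nat_mult)
    also have "m * y = exp (-A)"
      using m by (simp add: y_def exp_add exp_diff exp_minus field_simps)
    finally show ?thesis by simp
  qed
  also have "(\<Sum>T\<in>I. exp (- (\<epsilon> * m * B))) \<le> 2 ^ m * exp (- (\<epsilon> * m * B))"
  proof -
    have "card I \<le> card (Pow W)"
      using fin by (intro card_mono) (auto simp: I_def)
    then have "card I \<le> 2 ^ m" using fin by (simp add: card_Pow m_def)
    then have "real (card I) \<le> 2 ^ m" by (metis of_nat_le_iff of_nat_numeral of_nat_power)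
    then show ?thesis by (simp add: mult_right_mono)
  qed
  finally show ?thesis unfolding I_def m_def by simp
qed

text \<open>Chernoff with \<open>\<theta> = 1\<close>, using \<open>exp 1 - 1 \<le> 2\<close>.\<close>

lemma prob_large_degree:
  fixes p D :: real
  assumes W: "W \<subseteq> {..<n}" and p: "p \<in> {0..1}"
  shows "measure_pmf.prob (erdos_renyi n p) {E. \<exists>a\<in>W. D \<le> edge_count E {a} (W - {a})}
    \<le> card W * exp (2 * (card W * p) - D)"
proof -
  have fin: "finite W" using W finite_subset by auto
  have "measure_pmf.prob (erdos_renyi n p) {E. \<exists>a\<in>W. D \<le> edge_count E {a} (W - {a})}
      \<le> (\<Sum>a\<in>W. measure_pmf.prob (erdos_renyi n p) {E. D \<le> edge_count E {a} (W - {a})})"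
    by (rule prob_exists_le[OF fin])
  also have "\<dots> \<le> (\<Sum>a\<in>W. exp (2 * (card W * p) - D))"
  proof (intro sum_mono)
    fix a assume a: "a \<in> W"
    define N where "N = card {a} * card (W - {a})"
    have "measure_pmf.prob (erdos_renyi n p) {E. D \<le> edge_count E {a} (W - {a})}
        = measure_pmf.prob (binomial_pmf N p) {k. D \<le> 1 * real k}"
      unfolding N_def using a W p by (subst prob_edge_count) auto
    also have "\<dots> \<le> exp (real N * p * (exp 1 - 1) - D)"
      by (rule chernoff_bound_binomial[OF p])
    also have "real N * p * (exp 1 - 1) \<le> (card W * p) * 2"
      using p exp_le fin by (intro mult_mono) (auto simp: N_def card_Diff1_le)
    finally show "measure_pmf.prob (erdos_renyi n p) {E. D \<le> edge_count E {a} (W - {a})}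
        \<le> exp (2 * (card W * p) - D)" by (simp add: mult_ac)
  qed
  finally show ?thesis by simp
qed

lemma prob_boundary_deviates:
  fixes p \<eta> \<nu> :: real
  assumes "A \<subseteq> {..<n}" "B \<subseteq> {..<n}" "A \<inter> B = {}" and p: "p \<in> {0..1}" and \<eta>: "\<eta> > 0"
    and \<nu>: "\<nu> = card A * card B * p" "\<nu> > 0"
  shows "measure_pmf.prob (erdos_renyi n p) {E. \<eta> * \<nu> \<le> \<bar>edge_count E A B - \<nu>\<bar>} \<le> 1 / (\<eta>\<^sup>2 * \<nu>)"
proof -
  have "measure_pmf.prob (erdos_renyi n p) {E. \<eta> * \<nu> \<le> \<bar>edge_count E A B - \<nu>\<bar>}
      = measure_pmf.prob (binomial_pmf (card A * card B) p) {k. \<eta> * \<nu> \<le> \<bar>real k - \<nu>\<bar>}"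
    using assms(1-4) by (rule prob_edge_count)
  also have "\<dots> \<le> \<nu> / (\<eta> * \<nu>)\<^sup>2"
    using chebyshev_binomial[OF p, of "\<eta> * \<nu>" "card A * card B"] \<eta> \<nu>(2) by (simp add: \<nu>(1))
  also have "\<dots> = 1 / (\<eta>\<^sup>2 * \<nu>)"
    using \<nu>(2) by (simp add: power2_eq_square field_simps)
  finally show ?thesis .
qed

text \<open>Markov's inequality: each summand is the square of a binomial variable with mean \<open>\<sigma>\<close> and variance
  at most \<open>\<sigma>\<close>.\<close>

lemma prob_boundary_squares_large:
  fixes p K \<sigma> :: real
  assumes W: "W \<subseteq> {..<n}" and S: "S \<subseteq> {..<n}" and disj: "W \<inter> S = {}" and p: "p \<in> {0..1}" and K: "K > 0"
    and \<sigma>: "\<sigma> = card S * p" "\<sigma> > 0" and "W \<noteq> {}"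
  shows "measure_pmf.prob (erdos_renyi n p)
      {E. K * (\<sigma> + \<sigma>\<^sup>2) * card W \<le> (\<Sum>a\<in>W. (real (edge_count E {a} S))\<^sup>2)} \<le> 1 / K"
proof -
  define M where "M = measure_pmf (erdos_renyi n p)"
  have int: "integrable M f" for f :: "nat set set \<Rightarrow> real"
    unfolding M_def by (rule integrable_measure_pmf_finite[OF finite_set_pmf_erdos_renyi])
  have m: "card W > 0" using assms(8) W finite_subset by (auto simp: card_gt_0_iff)
  have each: "integral\<^sup>L M (\<lambda>E. (real (edge_count E {a} S))\<^sup>2) \<le> \<sigma> + \<sigma>\<^sup>2" if "a \<in> W" for a
  proof -
    have "integral\<^sup>L M (\<lambda>E. (real (edge_count E {a} S))\<^sup>2)
        = measure_pmf.expectation (map_pmf (\<lambda>E. edge_count E {a} S) (erdos_renyi n p)) (\<lambda>k. (real k)\<^sup>2)"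
      by (simp add: M_def)
    also have "map_pmf (\<lambda>E. edge_count E {a} S) (erdos_renyi n p) = binomial_pmf (card {a} * card S) p"
      using that W S disj p by (intro edge_count_binomial) auto
    also have "measure_pmf.expectation \<dots> (\<lambda>k. (real k)\<^sup>2) = \<sigma> * (1 - p) + \<sigma>\<^sup>2"
      by (simp add: binomial_second_moment[OF p] \<sigma>(1))
    also have "\<dots> \<le> \<sigma> + \<sigma>\<^sup>2" using p \<sigma>(2) by (simp add: mult_left_le)
    finally show ?thesis .
  qed
  have "measure M {E. K * (\<sigma> + \<sigma>\<^sup>2) * card W \<le> (\<Sum>a\<in>W. (real (edge_count E {a} S))\<^sup>2)}
      = measure M {E \<in> space M. K * (\<sigma> + \<sigma>\<^sup>2) * card W \<le> (\<Sum>a\<in>W. (real (edge_count E {a} S))\<^sup>2)}"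
    by (simp add: M_def)
  also have "\<dots> \<le> integral\<^sup>L M (\<lambda>E. \<Sum>a\<in>W. (real (edge_count E {a} S))\<^sup>2) / (K * (\<sigma> + \<sigma>\<^sup>2) * card W)"
    by (rule integral_Markov_inequality_measure[where A = "{}"])
      (use int K \<sigma>(2) m in \<open>auto simp: M_def sum_nonneg add_pos_pos\<close>)
  also have "integral\<^sup>L M (\<lambda>E. \<Sum>a\<in>W. (real (edge_count E {a} S))\<^sup>2) \<le> (\<Sum>a\<in>W. \<sigma> + \<sigma>\<^sup>2)"
  proof -
    have "integral\<^sup>L M (\<lambda>E. \<Sum>a\<in>W. (real (edge_count E {a} S))\<^sup>2)
        = (\<Sum>a\<in>W. integral\<^sup>L M (\<lambda>E. (real (edge_count E {a} S))\<^sup>2))"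
      using int by (intro Bochner_Integration.integral_sum)
    also have "\<dots> \<le> (\<Sum>a\<in>W. \<sigma> + \<sigma>\<^sup>2)" by (intro sum_mono each)
    finally show ?thesis .
  qed
  finally have "measure M {E. K * (\<sigma> + \<sigma>\<^sup>2) * card W \<le> (\<Sum>a\<in>W. (real (edge_count E {a} S))\<^sup>2)}
      \<le> (\<Sum>a\<in>W. \<sigma> + \<sigma>\<^sup>2) / (K * (\<sigma> + \<sigma>\<^sup>2) * card W)"
    using K \<sigma>(2) by (simp add: divide_right_mono)
  also have "\<dots> = 1 / K"
    using m \<sigma>(2) add_pos_pos[OF \<sigma>(2), of "\<sigma>\<^sup>2"] by simp
  finally show ?thesis unfolding M_def .
qed

section \<open>The eigenvalue for a fixed set of grounded nodes\<close>

text \<open>The eigenvalue bounds can fail only if expansion, the degree bound, the concentration of the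
  boundary or the bound on its squares fails; the right-hand side adds up the four probabilities
  (the first two summands belong to expansion).\<close>

lemma prob_eigenvalue_bounds_fail:
  fixes p t h \<Delta> \<epsilon> A B \<eta> K \<sigma> :: real
  assumes S: "S \<subseteq> {..<n}" "S \<noteq> {}" and W: "W = {..<n} - S" "W \<noteq> {}"
    and p: "0 < p" "p \<le> 1"
    and t: "0 \<le> t" and h: "0 \<le> h" and \<Delta>: "0 < \<Delta>" and \<epsilon>: "0 \<le> \<epsilon>" and B: "0 \<le> B"
    and small: "ln (card W) + A \<le> (1 - \<epsilon>) * card W * p * (1 - exp (-t)) - t * h"
    and large: "B \<le> card W * p * (1 - exp (-t)) / 2 - t * h"
    and \<eta>: "0 < \<eta>" and K: "0 < K" and \<sigma>: "\<sigma> = card S * p"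
    and gap: "(1 - \<eta>) * \<sigma> < h\<^sup>2 / (2 * \<Delta>)"
  shows "measure_pmf.prob (erdos_renyi n p)
     {E. \<not> ((1 - \<eta>) * \<sigma> - K * (\<sigma> + \<sigma>\<^sup>2) / (h\<^sup>2 / (2 * \<Delta>) - (1 - \<eta>) * \<sigma>)
               \<le> smallest_eigenvalue (grounded_laplacian n E S)
          \<and> smallest_eigenvalue (grounded_laplacian n E S) \<le> (1 + \<eta>) * \<sigma>)}
   \<le> (exp (exp (-A)) - 1) + 2 ^ card W * exp (- (\<epsilon> * card W * B))
     + card W * exp (2 * (card W * p) - \<Delta>) + 1 / (\<eta>\<^sup>2 * (\<sigma> * card W)) + 1 / K"
    (is "measure_pmf.prob ?G {E. \<not> ?good E} \<le> _")
proof -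
  have fin: "finite S" "finite W" using S W finite_subset by auto
  have m: "card W > 0" using fin W(2) by (simp add: card_gt_0_iff)
  have "card S > 0" using fin S(2) by (simp add: card_gt_0_iff)
  then have \<sigma>_pos: "\<sigma> > 0" unfolding \<sigma> using p by (intro mult_pos_pos) auto
  have W': "W \<subseteq> {..<n}" and disj: "W \<inter> S = {}" using W by auto
  have p': "p \<in> {0..1}" using p by simp
  define \<nu> where "\<nu> = \<sigma> * card W"
  have \<nu>: "\<nu> = card W * card S * p" "\<nu> > 0" using \<sigma>_pos m by (auto simp: \<nu>_def \<sigma>)
  define P1 where "P1 E \<longleftrightarrow> (\<exists>T\<in>{T. T \<subseteq> W \<and> T \<noteq> {} \<and> 2 * card T \<le> card W}.
    edge_count E T (W - T) \<le> h * card T)" for E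
  define P2 where "P2 E \<longleftrightarrow> (\<exists>a\<in>W. \<Delta> \<le> edge_count E {a} (W - {a}))" for E
  define P3 where "P3 E \<longleftrightarrow> \<eta> * \<nu> \<le> \<bar>edge_count E W S - \<nu>\<bar>" for E
  define P4 where "P4 E \<longleftrightarrow> K * (\<sigma> + \<sigma>\<^sup>2) * card W \<le> (\<Sum>a\<in>W. (real (edge_count E {a} S))\<^sup>2)" for E
  have good: "?good E" if E: "E \<subseteq> possible_edges n" and not: "\<not> P1 E" "\<not> P2 E" "\<not> P3 E" "\<not> P4 E" for E
  proof
    have boundary: "(\<Sum>a\<in>W. \<Sum>b\<in>S. adjacent E a b) = edge_count E W S"
      using fin by (simp add: edge_count_eq_sum)
    have close: "(1 - \<eta>) * \<nu> \<le> edge_count E W S" "edge_count E W S \<le> (1 + \<eta>) * \<nu>"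
      using not(3) unfolding P3_def by (auto simp: algebra_simps)
    show "(1 - \<eta>) * \<sigma> - K * (\<sigma> + \<sigma>\<^sup>2) / (h\<^sup>2 / (2 * \<Delta>) - (1 - \<eta>) * \<sigma>)
        \<le> smallest_eigenvalue (grounded_laplacian n E S)"
    proof (rule smallest_eigenvalue_lower[OF E S(1) W h \<Delta> _ _ _ _ gap])
      fix T assume T: "T \<subseteq> W" "2 * card T \<le> card W"
      show "h * card T \<le> (\<Sum>a\<in>T. \<Sum>b\<in>W - T. adjacent E a b)"
      proof (cases "T = {}")
        case False
        then have "h * card T \<le> edge_count E T (W - T)"
          using not(1) T unfolding P1_def by force
        then show ?thesis
          using T fin finite_subset[OF T(1)] by (simp add: edge_count_eq_sum)
      qed simp
    next
      fix a assume a: "a \<in> W"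
      then show "(\<Sum>b\<in>W. adjacent E a b) \<le> \<Delta>"
        using not(2) unfolding P2_def degree_eq_edge_count[OF E fin(2) a] by force
    next
      show "(1 - \<eta>) * \<sigma> * card W \<le> (\<Sum>a\<in>W. \<Sum>b\<in>S. adjacent E a b)"
        using close(1) unfolding boundary \<nu>_def by (simp add: mult_ac)
      have "(\<Sum>b\<in>S. adjacent E a b) = real (edge_count E {a} S)" for a
        using fin by (simp add: edge_count_eq_sum)
      then show "(\<Sum>a\<in>W. (\<Sum>b\<in>S. adjacent E a b)\<^sup>2) \<le> K * (\<sigma> + \<sigma>\<^sup>2) * card W"
        using not(4) unfolding P4_def by simp
    qed
    have "smallest_eigenvalue (grounded_laplacian n E S) * card W \<le> (1 + \<eta>) * \<sigma> * card W"
      using smallest_eigenvalue_upper[OF E S(1) W] close(2) unfolding boundary \<nu>_def by (simp add: mult_ac)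
    then show "smallest_eigenvalue (grounded_laplacian n E S) \<le> (1 + \<eta>) * \<sigma>"
      using m by simp
  qed
  have "measure_pmf.prob ?G {E. \<not> ?good E} \<le> measure_pmf.prob ?G {E. (((P1 E \<or> P2 E) \<or> P3 E) \<or> P4 E)}"
    using good set_pmf_erdos_renyi[of n p]
    by (intro measure_pmf.finite_measure_mono_AE AE_pmfI) (blast, simp)
  also have "\<dots> \<le> ((measure_pmf.prob ?G {E. P1 E} + measure_pmf.prob ?G {E. P2 E})
      + measure_pmf.prob ?G {E. P3 E}) + measure_pmf.prob ?G {E. P4 E}"
    by (intro order.trans[OF prob_disj_le] add_right_mono order.refl)
  also have "\<dots> \<le> (((exp (exp (-A)) - 1) + 2 ^ card W * exp (- (\<epsilon> * card W * B)))
      + card W * exp (2 * (card W * p) - \<Delta>) + 1 / (\<eta>\<^sup>2 * \<nu>)) + 1 / K"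
    unfolding P1_def P2_def P3_def P4_def
    by (intro add_mono prob_expansion_fails[OF W' W(2) p' t \<epsilon> B small large] prob_large_degree[OF W' p']
        prob_boundary_deviates[OF W' S(1) disj p' \<eta> \<nu>]
        prob_boundary_squares_large[OF W' S(1) disj p' K \<sigma> \<sigma>_pos W(2)])
  finally show ?thesis unfolding \<nu>_def .
qed

text \<open>Choice of the parameters, all in terms of \<open>\<mu> = n p\<close> and of \<open>\<epsilon>\<close>, where \<open>1 - 8 \<epsilon>\<close> is the
  constant \<open>c < 1\<close> with \<open>ln n \<le> c \<mu>\<close>. Taking \<open>t = ln (1 / \<epsilon>)\<close> and \<open>h = \<gamma> \<mu>\<close> with \<open>\<gamma> = \<epsilon> / t\<close> makes
  \<open>exp (-t) = \<epsilon>\<close> and \<open>t h = \<epsilon> \<mu>\<close>. Since \<open>m p \<ge> (1 - \<epsilon>) \<mu>\<close>, the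
  exponent per node for small sets, increased by \<open>ln n\<close>, is at most
  \<open>c + \<epsilon> - (1 - \<epsilon>) ^ 3 \<le> -4 \<epsilon>\<close> in units of \<open>\<mu>\<close>, and the exponent per node for large sets is at
  most \<open>\<epsilon> - (1 - \<epsilon>)\<^sup>2 / 2 \<le> -1 / 4\<close>. With the degree bound \<open>4 \<mu>\<close> the spectral gap is at least
  \<open>\<Lambda> = \<gamma>\<^sup>2 \<mu> / 8\<close>. The powers \<open>\<eta> = \<mu> powr (-1/3)\<close> and \<open>K = \<mu> powr (1/4)\<close> are one choice for which
  the failure probability \<open>1 / (\<eta>\<^sup>2 \<mu>)\<close>, the probability \<open>1 / K\<close> and the relative error
  \<open>K sqrt \<mu> / \<mu>\<close> all tend to zero.\<close>

lemma prob_eigenvalue_bounds_fail_large: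
  fixes p \<epsilon> \<gamma> \<mu> :: real
  defines "\<gamma> \<equiv> \<epsilon> / ln (1 / \<epsilon>)"
  assumes S: "S \<subseteq> {..<n}" "S \<noteq> {}" and p: "0 < p" "p \<le> 1" and \<mu>: "\<mu> = n * p"
    and \<epsilon>: "0 < \<epsilon>" "\<epsilon> \<le> 1 / 8"
    and dense: "ln n \<le> (1 - 8 * \<epsilon>) * \<mu>"
    and S_small: "card S \<le> sqrt \<mu>" "card S \<le> \<epsilon> * n"
    and \<mu>_large: "ln 2 \<le> \<epsilon> * \<mu> / 8" "sqrt \<mu> < \<gamma>\<^sup>2 / 8 * \<mu>"
  shows "measure_pmf.prob (erdos_renyi n p)
     {E. \<not> ((1 - (\<mu> powr (-1/3) + \<mu> powr (1/4) * (1 + sqrt \<mu>) / (\<gamma>\<^sup>2 / 8 * \<mu> - sqrt \<mu>))) * real (card S) * p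
               \<le> smallest_eigenvalue (grounded_laplacian n E S)
          \<and> smallest_eigenvalue (grounded_laplacian n E S) \<le> (1 + \<mu> powr (-1/3)) * real (card S) * p)}
   \<le> (exp (exp (-(4 * \<epsilon> * \<mu>))) - 1) + exp (-(\<epsilon> * \<mu> / 8)) + exp (-\<mu>) + 2 * \<mu> powr (-1/3) + \<mu> powr (-1/4)"
proof -
  define W where "W = {..<n} - S"
  define m where "m = real (card W)"
  define t where "t = ln (1 / \<epsilon>)"
  define h where "h = \<gamma> * \<mu>"
  define \<sigma> where "\<sigma> = card S * p"
  define \<eta> where "\<eta> = \<mu> powr (-1/3)"
  define K where "K = \<mu> powr (1/4)"
  define \<Lambda> where "\<Lambda> = \<gamma>\<^sup>2 / 8 * \<mu>"
  have "n > 0" using S by (cases n) auto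
  then have \<mu>_pos: "\<mu> > 0" using p \<mu> by simp
  have fin: "finite S" using S finite_subset by auto
  have s: "1 \<le> real (card S)" using S(2) fin by (simp add: Suc_le_eq card_gt_0_iff)
  have m_eq: "m = real n - real (card S)"
    unfolding m_def W_def using S fin card_mono[OF _ S(1)] by (simp add: card_Diff_subset of_nat_diff)
  have m_ge: "(1 - \<epsilon>) * n \<le> m" using S_small(2) m_eq by (simp add: algebra_simps)
  have m_le: "m \<le> n" using m_eq by simp
  have m_pos: "m > 0"
    using m_ge \<open>n > 0\<close> \<epsilon>(2) mult_pos_pos[of "1 - \<epsilon>" "real n"] by linarith
  then have m1: "1 \<le> m" unfolding m_def by (simp add: Suc_le_eq)
  have "W \<noteq> {}" using m_pos unfolding m_def by auto
  have mp: "(1 - \<epsilon>) * \<mu> \<le> m * p" using m_ge p unfolding \<mu> by (simp add: mult.assoc[symmetric])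
  have mp_le: "m * p \<le> \<mu>" unfolding \<mu> using m_le p by simp
  have mp_half: "\<mu> / 2 \<le> m * p"
    using mp mult_right_mono[of "1/2" "1 - \<epsilon>" \<mu>] \<epsilon> \<mu>_pos by linarith
  have t: "t > 0" unfolding t_def using \<epsilon> by simp
  have exp_t: "exp (-t) = \<epsilon>" unfolding t_def using \<epsilon> by (simp add: ln_div)
  have th: "t * h = \<epsilon> * \<mu>" unfolding h_def \<gamma>_def t_def[symmetric] using t by simp
  have \<gamma>: "\<gamma> > 0" unfolding \<gamma>_def t_def[symmetric] using t \<epsilon> by simp
  have \<Lambda>: "h\<^sup>2 / (2 * (4 * \<mu>)) = \<Lambda>"
    unfolding h_def \<Lambda>_def using \<mu>_pos by (simp add: power2_eq_square)
  have \<sigma>: "\<sigma> > 0" unfolding \<sigma>_def using s p by (simp add: mult_pos_pos)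
  have \<sigma>_le: "\<sigma> \<le> sqrt \<mu>"
    using S_small(1) p mult_left_le[of p "real (card S)"] unfolding \<sigma>_def by linarith
  have \<eta>: "\<eta> > 0" unfolding \<eta>_def using \<mu>_pos by simp
  have K: "K > 0" unfolding K_def using \<mu>_pos by simp
  have \<alpha>_le: "(1 - \<eta>) * \<sigma> \<le> \<sigma>" using \<eta> \<sigma> by simp
  have small: "ln (card W) + 4 * \<epsilon> * \<mu> \<le> (1 - \<epsilon>) * card W * p * (1 - exp (-t)) - t * h"
  proof -
    have "ln (card W) \<le> ln n" using m_pos m_le unfolding m_def by simp
    then have "ln (card W) + 4 * \<epsilon> * \<mu> + t * h \<le> (1 - 3 * \<epsilon>) * \<mu>"
      using dense unfolding th by (simp add: algebra_simps)
    also have "\<dots> \<le> ((1 - \<epsilon>) * (1 - \<epsilon>)) * ((1 - \<epsilon>) * \<mu>)"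
    proof -
      have "(1 - \<epsilon>) * (1 - \<epsilon>) * (1 - \<epsilon>) = 1 - 3 * \<epsilon> + \<epsilon>\<^sup>2 * (3 - \<epsilon>)"
        by (simp add: power2_eq_square algebra_simps)
      moreover have "\<epsilon>\<^sup>2 * (3 - \<epsilon>) \<ge> 0" using \<epsilon> by simp
      ultimately have "1 - 3 * \<epsilon> \<le> (1 - \<epsilon>) * (1 - \<epsilon>) * (1 - \<epsilon>)" by linarith
      then show ?thesis using \<mu>_pos by (simp add: mult_right_mono flip: mult.assoc)
    qed
    also have "\<dots> \<le> ((1 - \<epsilon>) * (1 - \<epsilon>)) * (m * p)"
      using mp \<epsilon> by (intro mult_left_mono) auto
    finally show ?thesis unfolding exp_t m_def by (simp add: mult_ac)
  qed
  have large: "\<mu> / 4 \<le> card W * p * (1 - exp (-t)) / 2 - t * h"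
  proof -
    have "\<mu> / 4 + \<epsilon> * \<mu> \<le> (1 - \<epsilon>) * (1 - \<epsilon>) / 2 * \<mu>"
    proof -
      have "1 / 4 + \<epsilon> \<le> (1 - \<epsilon>) * (1 - \<epsilon>) / 2"
      proof -
        have "(1 - \<epsilon>) * (1 - \<epsilon>) / 2 = 1 / 2 - \<epsilon> + \<epsilon> * \<epsilon> / 2" by (simp add: field_simps)
        then show ?thesis using \<epsilon> zero_le_square[of \<epsilon>] by linarith
      qed
      from mult_right_mono[OF this, of \<mu>] show ?thesis using \<mu>_pos by (simp add: algebra_simps)
    qed
    also have "\<dots> \<le> (1 - \<epsilon>) / 2 * (m * p)"
      using mult_left_mono[OF mp, of "(1 - \<epsilon>) / 2"] \<epsilon> by (simp add: mult_ac)
    finally show ?thesis unfolding exp_t th m_def by (simp add: mult_ac)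
  qed
  have gap: "(1 - \<eta>) * \<sigma> < h\<^sup>2 / (2 * (4 * \<mu>))"
    unfolding \<Lambda> using \<alpha>_le \<sigma>_le \<mu>_large(2) unfolding \<Lambda>_def by linarith
  have weaken: "(1 - (\<eta> + K * (1 + sqrt \<mu>) / (\<Lambda> - sqrt \<mu>))) * \<sigma>
      \<le> (1 - \<eta>) * \<sigma> - K * (\<sigma> + \<sigma>\<^sup>2) / (\<Lambda> - (1 - \<eta>) * \<sigma>)"
  proof -
    have "K * (\<sigma> + \<sigma>\<^sup>2) / (\<Lambda> - (1 - \<eta>) * \<sigma>) \<le> K * (1 + sqrt \<mu>) * \<sigma> / (\<Lambda> - sqrt \<mu>)"
    proof (rule frac_le)
      have "\<sigma> + \<sigma>\<^sup>2 \<le> (1 + sqrt \<mu>) * \<sigma>"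
        using \<sigma>_le \<sigma> by (simp add: power2_eq_square algebra_simps)
      then show "K * (\<sigma> + \<sigma>\<^sup>2) \<le> K * (1 + sqrt \<mu>) * \<sigma>"
        using K by (simp add: mult.assoc)
      show "0 < \<Lambda> - sqrt \<mu>" using \<mu>_large(2) unfolding \<Lambda>_def by simp
      show "\<Lambda> - sqrt \<mu> \<le> \<Lambda> - (1 - \<eta>) * \<sigma>" using \<alpha>_le \<sigma>_le by linarith
      show "0 \<le> K * (1 + sqrt \<mu>) * \<sigma>" using K \<sigma> \<mu>_pos by simp
    qed
    then show ?thesis by (simp add: algebra_simps)
  qed
  let ?low = "\<lambda>E. smallest_eigenvalue (grounded_laplacian n E S)"
  have "measure_pmf.prob (erdos_renyi n p)
      {E. \<not> ((1 - (\<eta> + K * (1 + sqrt \<mu>) / (\<Lambda> - sqrt \<mu>))) * \<sigma> \<le> ?low E \<and> ?low E \<le> (1 + \<eta>) * \<sigma>)}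
    \<le> measure_pmf.prob (erdos_renyi n p)
      {E. \<not> ((1 - \<eta>) * \<sigma> - K * (\<sigma> + \<sigma>\<^sup>2) / (\<Lambda> - (1 - \<eta>) * \<sigma>) \<le> ?low E \<and> ?low E \<le> (1 + \<eta>) * \<sigma>)}"
    using weaken by (intro measure_pmf.finite_measure_mono) auto
  also have "\<dots> \<le> (exp (exp (-(4 * \<epsilon> * \<mu>))) - 1) + 2 ^ card W * exp (- (\<epsilon> * m * (\<mu> / 4)))
      + m * exp (2 * (m * p) - 4 * \<mu>) + 1 / (\<eta>\<^sup>2 * (\<sigma> * m)) + 1 / K"
    unfolding m_def
    using prob_eigenvalue_bounds_fail[OF S W_def \<open>W \<noteq> {}\<close> p _ _ _ _ _ small large \<eta> K \<sigma>_def gap]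
      t \<gamma> \<mu>_pos \<epsilon> unfolding \<Lambda> by (simp add: h_def)
  also have "2 ^ card W * exp (- (\<epsilon> * m * (\<mu> / 4))) \<le> exp (-(\<epsilon> * \<mu> / 8))"
  proof -
    have "2 ^ card W = exp (m * ln 2)"
      unfolding m_def by (simp add: exp_of_nat_mult)
    then have "2 ^ card W * exp (- (\<epsilon> * m * (\<mu> / 4))) = exp (m * (ln 2 - \<epsilon> * \<mu> / 4))"
      by (simp add: exp_add[symmetric] algebra_simps)
    \<comment> \<open>half of the exponent absorbs the number \<open>2 ^ m\<close> of sets\<close>
    also have "m * (ln 2 - \<epsilon> * \<mu> / 4) \<le> m * (-(\<epsilon> * \<mu> / 8))"
      using \<mu>_large(1) m_pos by (intro mult_left_mono) auto
    also have "\<dots> \<le> 1 * (-(\<epsilon> * \<mu> / 8))"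
      using m1 \<epsilon> \<mu>_pos by (intro mult_right_mono_neg) auto
    finally show ?thesis by simp
  qed
  also have "m * exp (2 * (m * p) - 4 * \<mu>) \<le> exp (-\<mu>)"
  proof -
    have "ln n \<le> 1 * \<mu>"
      using dense mult_right_mono[of "1 - 8 * \<epsilon>" 1 \<mu>] \<epsilon> \<mu>_pos by linarith
    then have "exp (ln (real n)) \<le> exp \<mu>" by simp
    then have "real n \<le> exp \<mu>" using \<open>n > 0\<close> by simp
    then have "m * exp (2 * (m * p) - 4 * \<mu>) \<le> exp \<mu> * exp (2 * \<mu> - 4 * \<mu>)"
      using m_le mp_le by (intro mult_mono) auto
    also have "\<dots> = exp (-\<mu>)" by (simp add: exp_add[symmetric])
    finally show ?thesis .
  qed
  also have "1 / (\<eta>\<^sup>2 * (\<sigma> * m)) \<le> 2 * \<mu> powr (-1/3)"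
  proof -
    have "1 * (m * p) \<le> real (card S) * (m * p)"
      using s m_pos p by (intro mult_right_mono) auto
    also have "\<dots> = \<sigma> * m" by (simp add: \<sigma>_def)
    finally have "\<mu> / 2 \<le> \<sigma> * m" using mp_half by linarith
    then have "1 / (\<eta>\<^sup>2 * (\<sigma> * m)) \<le> 1 / (\<eta>\<^sup>2 * (\<mu> / 2))"
      using \<eta> \<mu>_pos \<sigma> m_pos by (intro divide_left_mono mult_left_mono mult_pos_pos) auto
    also have "\<eta>\<^sup>2 * \<mu> = \<mu> powr (1/3)"
    proof -
      have "\<eta>\<^sup>2 * \<mu> = \<mu> powr (-1/3) * \<mu> powr (-1/3) * \<mu> powr 1"
        using \<mu>_pos by (simp add: \<eta>_def power2_eq_square)
      also have "\<dots> = \<mu> powr (1/3)" by (simp only: powr_add[symmetric]) simp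
      finally show ?thesis .
    qed
    then have "1 / (\<eta>\<^sup>2 * (\<mu> / 2)) = 2 * \<mu> powr (-1/3)"
      using powr_minus_divide[of \<mu> "1/3"] by simp
    finally show ?thesis .
  qed
  also have "1 / K = \<mu> powr (-1/4)"
    unfolding K_def using powr_minus_divide[of \<mu> "1/4"] by simp
  finally show ?thesis
    unfolding \<eta>_def K_def \<Lambda>_def \<sigma>_def by (simp add: mult.assoc)
qed

section \<open>The limit theorem\<close>

lemma prob_pair_pmf_le:
  assumes "\<And>y. y \<in> set_pmf B \<Longrightarrow> measure_pmf.prob A {x. Q x y} \<le> \<delta>" and "0 \<le> \<delta>"
  shows "measure_pmf.prob (pair_pmf A B) {(x, y). Q x y} \<le> \<delta>"
proof -
  have "pair_pmf A B = bind_pmf B (\<lambda>y. map_pmf (\<lambda>x. (x, y)) A)"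
    unfolding pair_pmf_def map_pmf_def by (rule bind_commute_pmf)
  then have "emeasure (pair_pmf A B) {(x, y). Q x y} = (\<integral>\<^sup>+ y. emeasure A {x. Q x y} \<partial>B)"
    by (simp add: vimage_def)
  also have "\<dots> \<le> (\<integral>\<^sup>+ y. ennreal \<delta> \<partial>B)"
    using assms by (intro nn_integral_mono_AE AE_pmfI) (simp add: measure_pmf.emeasure_eq_measure)
  also have "\<dots> = ennreal \<delta>" by simp
  finally show ?thesis using assms(2) by (simp add: measure_pmf.emeasure_eq_measure)
qed

theorem theorem3:
  fixes p :: "nat \<Rightarrow> real" and s :: "nat \<Rightarrow> nat"
  assumes p_prob: "\<And>n. 0 \<le> p n \<and> p n \<le> 1"
    and p_limsup: "limsup (\<lambda>n. ereal (ln (real n)) / ereal (real n * p n)) < 1"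
    and s_size: "\<And>n. n \<ge> 1 \<Longrightarrow> 1 \<le> s n \<and> s n \<le> n"
    and s_small: "(\<lambda>n. real (s n)) \<in> o(\<lambda>n. sqrt (real n * p n))"
  shows "\<exists>h\<^sub>1 h\<^sub>2 :: nat \<Rightarrow> real. h\<^sub>1 \<longlonglongrightarrow> 0 \<and> h\<^sub>2 \<longlonglongrightarrow> 0 \<and>
    asymptotically_almost_surely (\<lambda>n. grounded_erdos_renyi n (p n) (s n))
      (\<lambda>n (E, S).
        (1 - h\<^sub>1 n) * real (card S) * p n \<le> smallest_eigenvalue (grounded_laplacian n E S) \<and>
        smallest_eigenvalue (grounded_laplacian n E S) \<le> (1 + h\<^sub>2 n) * real (card S) * p n)"
proof -
  define \<mu> where "\<mu> n = real n * p n" for n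
  obtain c where c: "0 \<le> c" "c < 1"
    and connected: "\<forall>\<^sub>F n in sequentially. 0 < p n \<and> ln (real n) \<le> c * \<mu> n"
  proof -
    obtain c0 where c0: "limsup (\<lambda>n. ereal (ln (real n)) / ereal (real n * p n)) < ereal c0" "ereal c0 < 1"
      using ereal_dense2[OF p_limsup] by auto
    have "\<forall>\<^sub>F n in sequentially. ereal (ln (real n)) / ereal (real n * p n) < ereal c0"
      using c0(1) by (rule Limsup_lessD)
    then have "\<forall>\<^sub>F n in sequentially. 0 < p n \<and> ln (real n) \<le> max c0 0 * \<mu> n"
      using eventually_ge_at_top[of 2]
    proof eventually_elim
      case (elim n)
      \<comment> \<open>in the extended reals the ratio is infinite at \<open>p n = 0\<close>\<close>
      have "p n \<noteq> 0"
      proof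
        assume "p n = 0"
        with elim(1) ln_div_zero_ereal[OF elim(2)] show False by simp
      qed
      with p_prob[of n] have "0 < p n" by auto
      then have \<mu>: "\<mu> n > 0" unfolding \<mu>_def using elim(2) by simp
      have "ereal (ln (real n)) / ereal (\<mu> n) = ereal (ln (real n) / \<mu> n)"
        using \<mu> by (simp add: divide_ereal_def divide_inverse)
      then have "ln (real n) / \<mu> n < c0" using elim(1) unfolding \<mu>_def[symmetric] by simp
      then have "ln (real n) \<le> c0 * \<mu> n" using \<mu> by (simp add: field_simps)
      also have "\<dots> \<le> max c0 0 * \<mu> n" using \<mu> by (intro mult_right_mono) auto
      finally show ?case using \<open>0 < p n\<close> by simp
    qed
    with that[of "max c0 0"] c0(2) show ?thesis by (simp add: one_ereal_def)
  qed
  have \<mu>_top: "filterlim \<mu> at_top sequentially"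
  proof (rule filterlim_at_top_mono)
    show "filterlim (\<lambda>n. ln (real n)) at_top sequentially" by real_asymp
    show "\<forall>\<^sub>F n in sequentially. ln (real n) \<le> \<mu> n"
      using connected
    proof eventually_elim
      case (elim n)
      then show ?case using c mult_right_mono[of c 1 "\<mu> n"] by (simp add: \<mu>_def)
    qed
  qed
  define \<epsilon> where "\<epsilon> = (1 - c) / 8"
  \<comment> \<open>the constants of \<open>prob_eigenvalue_bounds_fail_large\<close>, so that \<open>c = 1 - 8 \<epsilon>\<close>\<close>
  define \<gamma> where "\<gamma> = \<epsilon> / ln (1 / \<epsilon>)"
  have \<epsilon>: "0 < \<epsilon>" "\<epsilon> \<le> 1 / 8" "c = 1 - 8 * \<epsilon>" using c unfolding \<epsilon>_def by (auto simp: field_simps)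
  have \<gamma>: "\<gamma> > 0" unfolding \<gamma>_def using \<epsilon> by (intro divide_pos_pos ln_gt_zero) auto
  define H where "H x = x powr (-1/3) + x powr (1/4) * (1 + sqrt x) / (\<gamma>\<^sup>2 / 8 * x - sqrt x)" for x :: real
  define \<delta> where "\<delta> x = (exp (exp (-(4 * \<epsilon> * x))) - 1) + exp (-(\<epsilon> * x / 8)) + exp (-x)
      + 2 * x powr (-1/3) + x powr (-1/4)" for x :: real
  have H: "(H \<longlongrightarrow> 0) at_top" unfolding H_def using \<gamma> by real_asymp
  have \<delta>: "(\<delta> \<longlongrightarrow> 0) at_top" unfolding \<delta>_def using \<epsilon>(1) by real_asymp
  have eta: "((\<lambda>x::real. x powr (-1/3)) \<longlongrightarrow> 0) at_top" by real_asymp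
  have large: "\<forall>\<^sub>F x in at_top. ln 2 \<le> \<epsilon> * x / 8 \<and> sqrt x < \<gamma>\<^sup>2 / 8 * x"
    using \<epsilon>(1) \<gamma> by (intro eventually_conj; real_asymp)
  have s_sqrt: "\<forall>\<^sub>F n in sequentially. real (s n) \<le> sqrt (\<mu> n)"
  proof -
    have "\<forall>\<^sub>F n in sequentially. norm (real (s n)) \<le> 1 * norm (sqrt (real n * p n))"
      by (rule landau_o.smallD[OF s_small]) simp
    then show ?thesis by eventually_elim (use p_prob in \<open>simp add: \<mu>_def\<close>)
  qed
  have n_large: "\<forall>\<^sub>F n in sequentially. sqrt (real n) \<le> \<epsilon> * real n"
    using \<epsilon>(1) by real_asymp
  let ?good = "\<lambda>n E S. (1 - H (\<mu> n)) * real (card S) * p n \<le> smallest_eigenvalue (grounded_laplacian n E S) \<and>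
        smallest_eigenvalue (grounded_laplacian n E S) \<le> (1 + \<mu> n powr (-1/3)) * real (card S) * p n"
  let ?M = "\<lambda>n. grounded_erdos_renyi n (p n) (s n)"
  have fail: "\<forall>\<^sub>F n in sequentially. measure_pmf.prob (?M n) {(E, S). \<not> ?good n E S} \<le> \<delta> (\<mu> n)"
    using connected filterlim_iff[THEN iffD1, OF \<mu>_top, rule_format, OF large] s_sqrt n_large eventually_ge_at_top[of 1]
  proof eventually_elim
    case (elim n)
    \<comment> \<open>\<open>\<mu> n \<le> n\<close> turns \<open>|S| \<le> sqrt \<mu>\<close> into \<open>|S| \<le> \<epsilon> n\<close>\<close>
    have \<mu>: "0 \<le> \<mu> n" "\<mu> n \<le> n" using p_prob[of n] by (auto simp: \<mu>_def mult_left_le)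
    have "real (s n) \<le> \<epsilon> * n"
      using elim(3,4) real_sqrt_le_mono[OF \<mu>(2)] by linarith
    show ?case
      unfolding grounded_erdos_renyi_def
    proof (rule prob_pair_pmf_le)
      fix S assume "S \<in> set_pmf (pmf_of_set {S. S \<subseteq> {..<n} \<and> card S = s n})"
      moreover have "finite {S. S \<subseteq> {..<n} \<and> card S = s n}" by (simp add: finite_Collect_conjI)
      moreover have "{..<s n} \<in> {S. S \<subseteq> {..<n} \<and> card S = s n}" using s_size[OF elim(5)] by auto
      ultimately have S: "S \<subseteq> {..<n}" "card S = s n" by (subst (asm) set_pmf_of_set; blast)+
      then have "S \<noteq> {}" using s_size[OF elim(5)] by auto
      with S elim p_prob[of n] \<open>real (s n) \<le> \<epsilon> * n\<close> \<epsilon>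
      show "measure_pmf.prob (erdos_renyi n (p n)) {E. \<not> ?good n E S} \<le> \<delta> (\<mu> n)"
        unfolding H_def \<delta>_def \<gamma>_def
        by (intro prob_eigenvalue_bounds_fail_large) (auto simp: \<mu>_def)
    next
      show "0 \<le> \<delta> (\<mu> n)" unfolding \<delta>_def by simp
    qed
  qed
  have "(\<lambda>n. measure_pmf.prob (?M n) {(E, S). \<not> ?good n E S}) \<longlonglongrightarrow> 0"
  proof (rule tendsto_sandwich[where f = "\<lambda>_. 0", OF _ fail])
    show "(\<lambda>n. \<delta> (\<mu> n)) \<longlonglongrightarrow> 0" using \<delta> \<mu>_top by (rule filterlim_compose)
  qed auto
  then have "(\<lambda>n. 1 - measure_pmf.prob (?M n) {(E, S). \<not> ?good n E S}) \<longlonglongrightarrow> 1 - 0"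
    by (intro tendsto_intros)
  moreover have "1 - measure_pmf.prob (?M n) {(E, S). \<not> ?good n E S} = measure_pmf.prob (?M n) {(E, S). ?good n E S}" for n
  proof -
    have compl: "{(E, S). \<not> ?good n E S} = space (measure_pmf (?M n)) - {(E, S). ?good n E S}" by auto
    show ?thesis by (subst compl, subst measure_pmf.prob_compl) simp_all
  qed
  ultimately have "asymptotically_almost_surely ?M (\<lambda>n (E, S). ?good n E S)"
    unfolding asymptotically_almost_surely_def by simp
  moreover have "(\<lambda>n. H (\<mu> n)) \<longlonglongrightarrow> 0" using H \<mu>_top by (rule filterlim_compose)
  moreover have "(\<lambda>n. \<mu> n powr (-1/3)) \<longlonglongrightarrow> 0" using eta \<mu>_top by (rule filterlim_compose)
  ultimately show ?thesis by blast
qed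

end
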